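(* Let $\mathcal F[\sigma]$ be a fragment of logic equivalent to a variety of finite monoids $\mathbf V$ which is not a variety of groups. Let $L$ be a regular language and $s$ its stability index. Then the following statements are equivalent: (1) $L$ belongs to $\mathcal F[\sigma,+1,\mathrm{MOD}]$; (2) $L$ belongs to $\mathcal F[\sigma,+1,\mathrm{MOD}^{s}]$. Furthermore, if $\mathcal F[\sigma,+1]$ is decidable, then so is $\mathcal F[\sigma,+1,\mathrm{MOD}]$.
   Context: Logic. A word $u$ over a finite alphabet $A$ is a set of positions $0,\dots,|u|-1$ labelled by letters. Formulas are monadic second order formulas over words; a signature $\sigma$ is a set of numerical predicates, and letter predicates $\mathbf a(x)$ (position $x$ carries letter $a$) are always available, for letters of any finite alphabet. A fragment of logic $\mathcal F[\sigma]$ is a set of closed formulas of $\mathrm{MSO}[\sigma]$ that contains the quantifier-free formulas and is closed under conjunction, disjunction and quantifier-free substitution (if $\varphi\in\mathcal F[\sigma]$ and $\psi(x_1,\dots,x_n)$ is a quantifier-free subformula of $\varphi$, then replacing $\psi$ by another quantifier-free formula over $\sigma$ with the same set of free variables gives a formula of $\mathcal F[\sigma]$). For a class of predicates $\sigma'$, the enrichment $\mathcal F[\sigma,\sigma']$ is the closure of $\mathcal F[\sigma]$ under quantifier-free substitutions with predicates ranging over $\sigma\cup\sigma'$. $\mathcal F[\sigma]$ also denotes the class of languages defined by its formulas (over each finite alphabet). The symbol $+1$ denotes the class of descriptive local predicates $\mathbf a(x+k)$, $\mathbf a(\min+k)$, $\mathbf a(\max-k)$ for $k\ge0$, holding if the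 position $x+k$ (resp. the $k$-th position after the first one, the $k$-th position before the last one) is labelled by $a$. For $d\ge 1$, $\mathrm{MOD}^d$ consists of, for $0\le i<d$, the unary predicates $\mathbf{MOD}_i^d(x)$ (position $x$ is congruent to $i$ mod $d$) and the constants $\mathbf D_i^d$ (the length of the word is congruent to $i$ mod $d$); $\mathrm{MOD}=\bigcup_{d\ge1}\mathrm{MOD}^d$. A fragment is decidable if, given a regular language, one can decide whether it is definable by a formula of the fragment. When $+1$ is in the signature, recognition is by semigroups via morphisms from $A^+$ (languages are considered as subsets of $A^+$). Algebra. A variety of monoids is a nonempty class of finite monoids closed under division (quotients of submonoids) and finite direct products. $\mathcal F[\sigma]$ is equivalent to $\mathbf V$ if the languages definable in $\mathcal F[\sigma]$ are exactly those recognized by a monoid of $\mathbf V$. The stability index of a regular language $L$ with syntactic morphism $\eta_L:A^*\to M_L$ is the least positive integer $s$ with $\eta_L(A^s)=\eta_L(A^{2s})$. *)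

theory Defs
  imports "HOL-Algebra.Group" "HOL-Library.Nat_Bijection"
begin

section \<open>Words and predicates\<close>

text \<open>
  Letters are natural numbers, an alphabet is a finite set of letters, and the words over an
  alphabet \<open>A\<close> are the elements of \<open>lists A\<close>.

  A numerical predicate is given by its arity and by the tuples of positions it holds for in
  words of a given length (first argument).  It never sees the letters.
\<close>

type_synonym letter = nat
type_synonym word = "letter list"

datatype numpred = NumPred (np_arity: nat) (np_holds: "nat \<Rightarrow> nat list \<Rightarrow> bool")

text \<open>
  \<open>LetterAt a k\<close>, \<open>LetterFromMin a k\<close> and \<open>LetterFromMax a k\<close> are the predicates
  \<open>a(x+k)\<close>, \<open>a(min+k)\<close> and \<open>a(max-k)\<close>.  They are false when the position does not exist.
\<close>

datatype pred =
    Num numpred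
  | LetterAt letter nat
  | LetterFromMin letter nat
  | LetterFromMax letter nat

primrec arity :: "pred \<Rightarrow> nat" where
  "arity (Num P) = np_arity P"
| "arity (LetterAt a k) = 1"
| "arity (LetterFromMin a k) = 0"
| "arity (LetterFromMax a k) = 0"

primrec holds :: "word \<Rightarrow> pred \<Rightarrow> nat list \<Rightarrow> bool" where
  "holds w (Num P) is = np_holds P (length w) is"
| "holds w (LetterAt a k) is = (hd is + k < length w \<and> w ! (hd is + k) = a)"
| "holds w (LetterFromMin a k) is = (k < length w \<and> w ! k = a)"
| "holds w (LetterFromMax a k) is = (k < length w \<and> w ! (length w - 1 - k) = a)"

definition letter_preds :: "pred set" where
  "letter_preds = {LetterAt a 0 | a. True}"

definition plus_one :: "pred set" where
  "plus_one = {LetterAt a k | a k. True} \<union> {LetterFromMin a k | a k. True}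
     \<union> {LetterFromMax a k | a k. True}"

definition mod_pos :: "nat \<Rightarrow> nat \<Rightarrow> numpred" where
  "mod_pos d i = NumPred 1 (\<lambda>n is. hd is mod d = i)"

definition mod_len :: "nat \<Rightarrow> nat \<Rightarrow> numpred" where
  "mod_len d i = NumPred 0 (\<lambda>n is. n mod d = i)"

definition MOD_of :: "nat \<Rightarrow> pred set" where
  "MOD_of d = {Num (mod_pos d i) | i. i < d} \<union> {Num (mod_len d i) | i. i < d}"

definition MOD_all :: "pred set" where
  "MOD_all = (\<Union>d\<in>{1..}. MOD_of d)"


section \<open>Monadic second order formulas\<close>

text \<open>
  Equality of positions is not built in: it is a numerical predicate that a signature may or
  may not contain.
\<close>

datatype mso =
    FTrue
  | FFalse
  | Atom pred "nat list"
  | Mem nat nat  \<comment> \<open>\<open>Mem x X\<close>: the position \<open>x\<close> belongs to the set \<open>X\<close>\<close>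
  | Neg mso
  | Conj mso mso
  | Disj mso mso
  | Ex1 nat mso
  | All1 nat mso
  | Ex2 nat mso
  | All2 nat mso

primrec sat :: "word \<Rightarrow> (nat \<Rightarrow> nat) \<Rightarrow> (nat \<Rightarrow> nat set) \<Rightarrow> mso \<Rightarrow> bool" where
  "sat w e E FTrue = True"
| "sat w e E FFalse = False"
| "sat w e E (Atom p xs) = holds w p (map e xs)"
| "sat w e E (Mem x X) = (e x \<in> E X)"
| "sat w e E (Neg \<phi>) = (\<not> sat w e E \<phi>)"
| "sat w e E (Conj \<phi> \<psi>) = (sat w e E \<phi> \<and> sat w e E \<psi>)"
| "sat w e E (Disj \<phi> \<psi>) = (sat w e E \<phi> \<or> sat w e E \<psi>)"
| "sat w e E (Ex1 x \<phi>) = (\<exists>i<length w. sat w (e(x := i)) E \<phi>)"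
| "sat w e E (All1 x \<phi>) = (\<forall>i<length w. sat w (e(x := i)) E \<phi>)"
| "sat w e E (Ex2 X \<phi>) = (\<exists>I\<subseteq>{..<length w}. sat w e (E(X := I)) \<phi>)"
| "sat w e E (All2 X \<phi>) = (\<forall>I\<subseteq>{..<length w}. sat w e (E(X := I)) \<phi>)"

text \<open>Free variables: \<open>Inl\<close> for first order and \<open>Inr\<close> for set variables.\<close>

primrec fv :: "mso \<Rightarrow> (nat + nat) set" where
  "fv FTrue = {}"
| "fv FFalse = {}"
| "fv (Atom p xs) = Inl ` set xs"
| "fv (Mem x X) = {Inl x, Inr X}"
| "fv (Neg \<phi>) = fv \<phi>"
| "fv (Conj \<phi> \<psi>) = fv \<phi> \<union> fv \<psi>"
| "fv (Disj \<phi> \<psi>) = fv \<phi> \<union> fv \<psi>"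
| "fv (Ex1 x \<phi>) = fv \<phi> - {Inl x}"
| "fv (All1 x \<phi>) = fv \<phi> - {Inl x}"
| "fv (Ex2 X \<phi>) = fv \<phi> - {Inr X}"
| "fv (All2 X \<phi>) = fv \<phi> - {Inr X}"

primrec quantifier_free :: "mso \<Rightarrow> bool" where
  "quantifier_free FTrue = True"
| "quantifier_free FFalse = True"
| "quantifier_free (Atom p xs) = True"
| "quantifier_free (Mem x X) = True"
| "quantifier_free (Neg \<phi>) = quantifier_free \<phi>"
| "quantifier_free (Conj \<phi> \<psi>) = (quantifier_free \<phi> \<and> quantifier_free \<psi>)"
| "quantifier_free (Disj \<phi> \<psi>) = (quantifier_free \<phi> \<and> quantifier_free \<psi>)"
| "quantifier_free (Ex1 x \<phi>) = False"
| "quantifier_free (All1 x \<phi>) = False"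
| "quantifier_free (Ex2 X \<phi>) = False"
| "quantifier_free (All2 X \<phi>) = False"

text \<open>Well-formed formulas whose predicates belong to \<open>\<tau>\<close> or are letter predicates.\<close>

primrec formula_over :: "pred set \<Rightarrow> mso \<Rightarrow> bool" where
  "formula_over \<tau> FTrue = True"
| "formula_over \<tau> FFalse = True"
| "formula_over \<tau> (Atom p xs) = (p \<in> \<tau> \<union> letter_preds \<and> length xs = arity p)"
| "formula_over \<tau> (Mem x X) = True"
| "formula_over \<tau> (Neg \<phi>) = formula_over \<tau> \<phi>"
| "formula_over \<tau> (Conj \<phi> \<psi>) = (formula_over \<tau> \<phi> \<and> formula_over \<tau> \<psi>)"
| "formula_over \<tau> (Disj \<phi> \<psi>) = (formula_over \<tau> \<phi> \<and> formula_over \<tau> \<psi>)"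
| "formula_over \<tau> (Ex1 x \<phi>) = formula_over \<tau> \<phi>"
| "formula_over \<tau> (All1 x \<phi>) = formula_over \<tau> \<phi>"
| "formula_over \<tau> (Ex2 X \<phi>) = formula_over \<tau> \<phi>"
| "formula_over \<tau> (All2 X \<phi>) = formula_over \<tau> \<phi>"

definition closed_formulas :: "pred set \<Rightarrow> mso set" where
  "closed_formulas \<tau> = {\<phi>. formula_over \<tau> \<phi> \<and> fv \<phi> = {}}"

text \<open>
  \<open>qf_subst \<tau> \<phi> \<phi>'\<close>: one occurrence of a quantifier-free subformula of \<open>\<phi>\<close> is replaced by a
  quantifier-free formula over \<open>\<tau>\<close> with the same free variables.
\<close>

inductive qf_subst :: "pred set \<Rightarrow> mso \<Rightarrow> mso \<Rightarrow> bool" for \<tau> where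
  replace: "\<lbrakk>quantifier_free \<psi>; quantifier_free \<psi>'; formula_over \<tau> \<psi>'; fv \<psi>' = fv \<psi>\<rbrakk>
    \<Longrightarrow> qf_subst \<tau> \<psi> \<psi>'"
| neg: "qf_subst \<tau> \<phi> \<phi>' \<Longrightarrow> qf_subst \<tau> (Neg \<phi>) (Neg \<phi>')"
| conj_left: "qf_subst \<tau> \<phi> \<phi>' \<Longrightarrow> qf_subst \<tau> (Conj \<phi> \<psi>) (Conj \<phi>' \<psi>)"
| conj_right: "qf_subst \<tau> \<psi> \<psi>' \<Longrightarrow> qf_subst \<tau> (Conj \<phi> \<psi>) (Conj \<phi> \<psi>')"
| disj_left: "qf_subst \<tau> \<phi> \<phi>' \<Longrightarrow> qf_subst \<tau> (Disj \<phi> \<psi>) (Disj \<phi>' \<psi>)"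
| disj_right: "qf_subst \<tau> \<psi> \<psi>' \<Longrightarrow> qf_subst \<tau> (Disj \<phi> \<psi>) (Disj \<phi> \<psi>')"
| ex1: "qf_subst \<tau> \<phi> \<phi>' \<Longrightarrow> qf_subst \<tau> (Ex1 x \<phi>) (Ex1 x \<phi>')"
| all1: "qf_subst \<tau> \<phi> \<phi>' \<Longrightarrow> qf_subst \<tau> (All1 x \<phi>) (All1 x \<phi>')"
| ex2: "qf_subst \<tau> \<phi> \<phi>' \<Longrightarrow> qf_subst \<tau> (Ex2 X \<phi>) (Ex2 X \<phi>')"
| all2: "qf_subst \<tau> \<phi> \<phi>' \<Longrightarrow> qf_subst \<tau> (All2 X \<phi>) (All2 X \<phi>')"


section \<open>Fragments of logic\<close>

definition fragment :: "numpred set \<Rightarrow> mso set \<Rightarrow> bool" where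
  "fragment \<sigma> F \<longleftrightarrow>
     F \<subseteq> closed_formulas (Num ` \<sigma>) \<and>
     {\<phi> \<in> closed_formulas (Num ` \<sigma>). quantifier_free \<phi>} \<subseteq> F \<and>
     (\<forall>\<phi>\<in>F. \<forall>\<psi>\<in>F. Conj \<phi> \<psi> \<in> F) \<and>
     (\<forall>\<phi>\<in>F. \<forall>\<psi>\<in>F. Disj \<phi> \<psi> \<in> F) \<and>
     (\<forall>\<phi>\<in>F. \<forall>\<phi>'. qf_subst (Num ` \<sigma>) \<phi> \<phi>' \<longrightarrow> \<phi>' \<in> F)"

definition enrichment :: "numpred set \<Rightarrow> mso set \<Rightarrow> pred set \<Rightarrow> mso set" where
  "enrichment \<sigma> F \<sigma>' = {\<phi>'. \<exists>\<phi>\<in>F. (qf_subst (Num ` \<sigma> \<union> \<sigma>'))\<^sup>*\<^sup>* \<phi> \<phi>'}"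

text \<open>The assignments are irrelevant for closed formulas.\<close>

definition models :: "word \<Rightarrow> mso \<Rightarrow> bool" where
  "models w \<phi> \<longleftrightarrow> sat w (\<lambda>_. 0) (\<lambda>_. {}) \<phi>"

definition nonempty_words :: "letter set \<Rightarrow> word set" where
  "nonempty_words A = lists A - {[]}"

definition definable :: "mso set \<Rightarrow> letter set \<Rightarrow> word set \<Rightarrow> bool" where
  "definable F A L \<longleftrightarrow> (\<exists>\<phi>\<in>F. L = {w \<in> lists A. models w \<phi>})"

definition definable_plus :: "mso set \<Rightarrow> letter set \<Rightarrow> word set \<Rightarrow> bool" where
  "definable_plus F A L \<longleftrightarrow> (\<exists>\<phi>\<in>F. L = {w \<in> nonempty_words A. models w \<phi>})"


section \<open>Varieties of finite monoids\<close>

text \<open>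
  A class of finite monoids is represented by its members with carrier in the natural numbers;
  every finite monoid has an isomorphic copy of this kind.
\<close>

definition finite_monoid :: "('a, 'b) monoid_scheme \<Rightarrow> bool" where
  "finite_monoid M \<longleftrightarrow> monoid M \<and> finite (carrier M)"

definition monoid_hom :: "('a, 'c) monoid_scheme \<Rightarrow> ('b, 'd) monoid_scheme \<Rightarrow> ('a \<Rightarrow> 'b) set" where
  "monoid_hom M N = {h \<in> hom M N. h \<one>\<^bsub>M\<^esub> = \<one>\<^bsub>N\<^esub>}"

definition divides :: "('a, 'c) monoid_scheme \<Rightarrow> ('b, 'd) monoid_scheme \<Rightarrow> bool" where
  "divides N M \<longleftrightarrow> (\<exists>S h. submonoid S M \<and> h \<in> monoid_hom (M\<lparr>carrier := S\<rparr>) N \<and> h ` S = carrier N)"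

definition monoid_variety :: "nat monoid set \<Rightarrow> bool" where
  "monoid_variety V \<longleftrightarrow>
     V \<noteq> {} \<and>
     (\<forall>M\<in>V. finite_monoid M) \<and>
     (\<forall>M\<in>V. \<forall>N. finite_monoid N \<and> divides N M \<longrightarrow> N \<in> V) \<and>
     (\<forall>M\<in>V. \<forall>N\<in>V. \<forall>P. finite_monoid P \<and> P \<cong> M \<times>\<times> N \<longrightarrow> P \<in> V)"

definition variety_of_groups :: "nat monoid set \<Rightarrow> bool" where
  "variety_of_groups V \<longleftrightarrow> monoid_variety V \<and> (\<forall>M\<in>V. group M)"

definition free_monoid :: "letter set \<Rightarrow> word monoid" where
  "free_monoid A = \<lparr>carrier = lists A, mult = (@), one = []\<rparr>"

definition recognizes :: "nat monoid \<Rightarrow> letter set \<Rightarrow> word set \<Rightarrow> bool" where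
  "recognizes M A L \<longleftrightarrow>
     (\<exists>h\<in>monoid_hom (free_monoid A) M. \<exists>P\<subseteq>carrier M. L = {w \<in> lists A. h w \<in> P})"

definition equivalent_to_variety :: "mso set \<Rightarrow> nat monoid set \<Rightarrow> bool" where
  "equivalent_to_variety F V \<longleftrightarrow>
     (\<forall>A L. finite A \<longrightarrow> definable F A L \<longleftrightarrow> (\<exists>M\<in>V. recognizes M A L))"


section \<open>Stability index\<close>

definition syntactic_congruence :: "letter set \<Rightarrow> word set \<Rightarrow> (word \<times> word) set" where
  "syntactic_congruence A L =
     {(u, v). u \<in> lists A \<and> v \<in> lists A \<and>
        (\<forall>x\<in>lists A. \<forall>y\<in>lists A. x @ u @ y \<in> L \<longleftrightarrow> x @ v @ y \<in> L)}"

text \<open>The elements of the syntactic monoid are the classes of the syntactic congruence.\<close>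

definition syntactic_morphism :: "letter set \<Rightarrow> word set \<Rightarrow> word \<Rightarrow> word set" where
  "syntactic_morphism A L u = syntactic_congruence A L `` {u}"

definition words_of_length :: "letter set \<Rightarrow> nat \<Rightarrow> word set" where
  "words_of_length A n = {w \<in> lists A. length w = n}"

definition stability_index :: "letter set \<Rightarrow> word set \<Rightarrow> nat" where
  "stability_index A L = (LEAST s. 0 < s \<and>
     syntactic_morphism A L ` words_of_length A s =
     syntactic_morphism A L ` words_of_length A (2 * s))"


section \<open>Regular languages and decidability\<close>

text \<open>
  Nondeterministic finite automata; the states are those occurring in the lists.  Every value of
  the type is an automaton: transitions on letters outside the alphabet are simply never used.
\<close>

datatype nfa = NFA (alphabet: "letter list") (transitions: "(nat \<times> letter \<times> nat) list")
  (initial: "nat list") (final: "nat list")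

primrec accepts_from :: "nfa \<Rightarrow> nat \<Rightarrow> word \<Rightarrow> bool" where
  "accepts_from N p [] = (p \<in> set (final N))"
| "accepts_from N p (a # w) = (\<exists>q. (p, a, q) \<in> set (transitions N) \<and> accepts_from N q w)"

definition nfa_language :: "nfa \<Rightarrow> word set" where
  "nfa_language N = {w \<in> lists (set (alphabet N)). \<exists>p\<in>set (initial N). accepts_from N p w}"

definition regular :: "letter set \<Rightarrow> word set \<Rightarrow> bool" where
  "regular A L \<longleftrightarrow> (\<exists>N. set (alphabet N) = A \<and> nfa_language N = L)"

primrec encode_nfa :: "nfa \<Rightarrow> nat" where
  "encode_nfa (NFA as ts is fs) =
     list_encode [list_encode as,
       list_encode (map (\<lambda>(p, a, q). prod_encode (p, prod_encode (a, q))) ts),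
       list_encode is, list_encode fs]"

text \<open>
  \<open>recursive n f\<close>: the restriction of \<open>f\<close> to lists of length \<open>n\<close> is a total recursive function
  of \<open>n\<close> arguments; minimization is only applied to regular functions.  The values of \<open>f\<close> on
  lists of other lengths have no meaning.
\<close>

inductive recursive :: "nat \<Rightarrow> (nat list \<Rightarrow> nat) \<Rightarrow> bool" where
  zero: "recursive n (\<lambda>xs. 0)"
| succ: "recursive 1 (\<lambda>xs. Suc (xs ! 0))"
| proj: "i < n \<Longrightarrow> recursive n (\<lambda>xs. xs ! i)"
| comp: "\<lbrakk>recursive (length gs) f; \<forall>g\<in>set gs. recursive n g\<rbrakk>
    \<Longrightarrow> recursive n (\<lambda>xs. f (map (\<lambda>g. g xs) gs))"
| prim_rec: "\<lbrakk>recursive n f; recursive (n + 2) g\<rbrakk>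
    \<Longrightarrow> recursive (n + 1) (\<lambda>xs. rec_nat (f (tl xs)) (\<lambda>y r. g (y # r # tl xs)) (hd xs))"
| minim: "\<lbrakk>recursive (n + 1) f; \<forall>xs. length xs = n \<longrightarrow> (\<exists>y. f (y # xs) = 0)\<rbrakk>
    \<Longrightarrow> recursive n (\<lambda>xs. LEAST y. f (y # xs) = 0)"

text \<open>
  A fragment with local predicates is decidable if definability of the language of nonempty words
  accepted by a given automaton is decidable.
\<close>

definition decidable_plus :: "mso set \<Rightarrow> bool" where
  "decidable_plus F \<longleftrightarrow>
     (\<exists>f. recursive 1 f \<and>
        (\<forall>N. f [encode_nfa N] =
           (if definable_plus F (set (alphabet N)) (nfa_language N - {[]}) then 1 else 0)))"

end

theory Submission
  imports Defs
begin

text \<open>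
  Definability in \<open>F[\<sigma>, +1, MOD\<^sup>d]\<close> is reduced to definability in \<open>F\<close>: it means that, once the
  two ends of the word and its length modulo \<open>d\<close> are fixed, membership of \<open>u\<close> is decided by an
  \<open>F\<close>-definable condition on the word of windows of \<open>u\<close>, whose \<open>x\<close>-th letter consists of the
  factor of length \<open>k\<close> starting at \<open>x\<close> and of \<open>x mod d\<close>.

  If \<open>s\<close> is stable and divides \<open>d\<close>, every factor of length \<open>s\<close> is syntactically equivalent to
  a word of length \<open>d\<close>. Replacing the successive blocks of length \<open>s\<close> of \<open>u\<close> by such words turns
  \<open>u\<close> into an equivalent word whose windows modulo \<open>d\<close> are the image, under a morphism that only
  reads the letters at block starts, of larger windows of \<open>u\<close> modulo \<open>s\<close>. As varieties yield
  closure under inverse morphisms, \<open>MOD\<^sup>d\<close> can be replaced by \<open>MOD\<^sup>s\<close>.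

  For decidability, \<open>L\<close> is in \<open>F[\<sigma>, +1, MOD\<^sup>s]\<close> iff the language of the words of \<open>L\<close> with each
  position annotated by its residue modulo \<open>s\<close> is in \<open>F[\<sigma>, +1]\<close>; that annotations are consistent
  is expressible because \<open>V\<close> contains a monoid that is not a group. The stability index need not
  be computed, since any stable length serves, and the factorial of a bound computed from the code
  of the automaton is one.
\<close>

section \<open>Substitution of atoms\<close>

primrec subst_atoms :: "(pred \<Rightarrow> nat list \<Rightarrow> mso) \<Rightarrow> mso \<Rightarrow> mso" where
  "subst_atoms g FTrue = FTrue"
| "subst_atoms g FFalse = FFalse"
| "subst_atoms g (Atom p xs) = g p xs"
| "subst_atoms g (Mem x X) = Mem x X"
| "subst_atoms g (Neg \<phi>) = Neg (subst_atoms g \<phi>)"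
| "subst_atoms g (Conj \<phi> \<psi>) = Conj (subst_atoms g \<phi>) (subst_atoms g \<psi>)"
| "subst_atoms g (Disj \<phi> \<psi>) = Disj (subst_atoms g \<phi>) (subst_atoms g \<psi>)"
| "subst_atoms g (Ex1 x \<phi>) = Ex1 x (subst_atoms g \<phi>)"
| "subst_atoms g (All1 x \<phi>) = All1 x (subst_atoms g \<phi>)"
| "subst_atoms g (Ex2 X \<phi>) = Ex2 X (subst_atoms g \<phi>)"
| "subst_atoms g (All2 X \<phi>) = All2 X (subst_atoms g \<phi>)"

text \<open>These are side conditions of \<open>qf_subst\<close>, so that replacing all atoms
  amounts to a sequence of legal substitutions. They cover argument lists of the wrong length as
  well, which lets \<open>fv_subst_atoms\<close> hold for arbitrary formulas.\<close>

definition atom_map :: "(pred \<Rightarrow> nat list \<Rightarrow> mso) \<Rightarrow> bool" where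
  "atom_map g \<longleftrightarrow> (\<forall>p xs. quantifier_free (g p xs) \<and> fv (g p xs) = Inl ` set xs)"

definition maps_into :: "(pred \<Rightarrow> nat list \<Rightarrow> mso) \<Rightarrow> pred set \<Rightarrow> pred set \<Rightarrow> bool" where
  "maps_into g \<tau>' \<tau> \<longleftrightarrow>
     (\<forall>p xs. p \<in> \<tau>' \<union> letter_preds \<longrightarrow> length xs = arity p \<longrightarrow> formula_over \<tau> (g p xs))"

lemma fv_subst_atoms: "atom_map g \<Longrightarrow> fv (subst_atoms g \<phi>) = fv \<phi>"
  by (induction \<phi>) (auto simp: atom_map_def)

lemma quantifier_free_subst_atoms:
  "atom_map g \<Longrightarrow> quantifier_free \<phi> \<Longrightarrow> quantifier_free (subst_atoms g \<phi>)"
  by (induction \<phi>) (auto simp: atom_map_def)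

lemma formula_over_subst_atoms:
  "maps_into g \<tau>' \<tau> \<Longrightarrow> formula_over \<tau>' \<phi> \<Longrightarrow> formula_over \<tau> (subst_atoms g \<phi>)"
  by (induction \<phi>) (auto simp: maps_into_def)

lemma formula_over_mono: "\<tau> \<subseteq> \<tau>' \<Longrightarrow> formula_over \<tau> \<phi> \<Longrightarrow> formula_over \<tau>' \<phi>"
  by (induction \<phi>) auto

lemma qf_subst_mono: "qf_subst \<tau> \<phi> \<phi>' \<Longrightarrow> \<tau> \<subseteq> \<tau>' \<Longrightarrow> qf_subst \<tau>' \<phi> \<phi>'"
  by (induction rule: qf_subst.induct) (auto intro: qf_subst.intros formula_over_mono)

lemma qf_subst_fv: "qf_subst \<tau> \<phi> \<phi>' \<Longrightarrow> fv \<phi>' = fv \<phi>"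
  by (induction rule: qf_subst.induct) auto

lemma qf_subst_formula_over: "qf_subst \<tau> \<phi> \<phi>' \<Longrightarrow> formula_over \<tau> \<phi> \<Longrightarrow> formula_over \<tau> \<phi>'"
  by (induction rule: qf_subst.induct) auto

text \<open>A step over the rich signature \<open>\<tau>'\<close> becomes a step over
  \<open>\<tau>\<close>, since the inserted formula is translated along with the rest.\<close>

lemma qf_subst_subst_atoms:
  assumes "atom_map g" "maps_into g \<tau>' \<tau>"
  shows "qf_subst \<tau>' \<phi> \<phi>' \<Longrightarrow> qf_subst \<tau> (subst_atoms g \<phi>) (subst_atoms g \<phi>')"
  by (induction rule: qf_subst.induct)
    (auto intro: qf_subst.intros
      simp: assms quantifier_free_subst_atoms fv_subst_atoms formula_over_subst_atoms[OF assms(2)])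

lemma rtranclp_map:
  "R\<^sup>*\<^sup>* x y \<Longrightarrow> (\<And>x y. R x y \<Longrightarrow> S (f x) (f y)) \<Longrightarrow> S\<^sup>*\<^sup>* (f x) (f y)"
  by (induction rule: rtranclp_induct) (auto intro: rtranclp.rtrancl_into_rtrancl)

lemma qf_substs_Conj:
  assumes "(qf_subst \<tau>)\<^sup>*\<^sup>* \<phi> \<phi>'" "(qf_subst \<tau>)\<^sup>*\<^sup>* \<psi> \<psi>'"
  shows "(qf_subst \<tau>)\<^sup>*\<^sup>* (Conj \<phi> \<psi>) (Conj \<phi>' \<psi>')"
  using rtranclp_map[OF assms(1), of "qf_subst \<tau>" "\<lambda>\<phi>. Conj \<phi> \<psi>"]
    rtranclp_map[OF assms(2), of "qf_subst \<tau>" "Conj \<phi>'"]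
  by (meson qf_subst.conj_left qf_subst.conj_right rtranclp_trans)

lemma qf_substs_Disj:
  assumes "(qf_subst \<tau>)\<^sup>*\<^sup>* \<phi> \<phi>'" "(qf_subst \<tau>)\<^sup>*\<^sup>* \<psi> \<psi>'"
  shows "(qf_subst \<tau>)\<^sup>*\<^sup>* (Disj \<phi> \<psi>) (Disj \<phi>' \<psi>')"
  using rtranclp_map[OF assms(1), of "qf_subst \<tau>" "\<lambda>\<phi>. Disj \<phi> \<psi>"]
    rtranclp_map[OF assms(2), of "qf_subst \<tau>" "Disj \<phi>'"]
  by (meson qf_subst.disj_left qf_subst.disj_right rtranclp_trans)

lemma qf_substs_subst_atoms:
  assumes g: "atom_map g" "maps_into g \<tau>' \<tau>"
  shows "formula_over \<tau>' \<phi> \<Longrightarrow> (qf_subst \<tau>)\<^sup>*\<^sup>* \<phi> (subst_atoms g \<phi>)"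
proof (induction \<phi>)
  case (Atom p xs)
  then have "qf_subst \<tau> (Atom p xs) (g p xs)"
    using g by (intro qf_subst.replace) (auto simp: atom_map_def maps_into_def)
  then show ?case by simp
next
  case (Neg \<phi>)
  then show ?case by (simp add: rtranclp_map[where f = Neg] qf_subst.neg)
next
  case (Ex1 x \<phi>)
  then show ?case by (simp add: rtranclp_map[where f = "Ex1 x"] qf_subst.ex1)
next
  case (All1 x \<phi>)
  then show ?case by (simp add: rtranclp_map[where f = "All1 x"] qf_subst.all1)
next
  case (Ex2 X \<phi>)
  then show ?case by (simp add: rtranclp_map[where f = "Ex2 X"] qf_subst.ex2)
next
  case (All2 X \<phi>)
  then show ?case by (simp add: rtranclp_map[where f = "All2 X"] qf_subst.all2)
qed (simp_all add: qf_substs_Conj qf_substs_Disj)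

text \<open>As \<open>w\<close> and \<open>w'\<close> have the same length, quantifiers range over
  the same positions and sets, and only atoms have to be compared. They are compared at existing
  positions only, a property of the assignment that quantification preserves.\<close>

lemma sat_subst_atoms:
  assumes "length w' = length w"
    and "\<And>p xs e E. p \<in> \<tau> \<union> letter_preds \<Longrightarrow> length xs = arity p \<Longrightarrow>
      \<forall>x\<in>set xs. e x < length w \<Longrightarrow> sat w' e E (g p xs) \<longleftrightarrow> holds w p (map e xs)"
  shows "formula_over \<tau> \<phi> \<Longrightarrow> \<forall>x. Inl x \<in> fv \<phi> \<longrightarrow> e x < length w \<Longrightarrow>
    sat w' e E (subst_atoms g \<phi>) \<longleftrightarrow> sat w e E \<phi>"
proof (induction \<phi> arbitrary: e E)
  case (Atom p xs)
  then show ?case using assms(2) by auto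
next
  case (Ex1 x \<phi>)
  have "\<And>i. i < length w \<Longrightarrow>
      sat w' (e(x := i)) E (subst_atoms g \<phi>) \<longleftrightarrow> sat w (e(x := i)) E \<phi>"
    using Ex1.prems by (intro Ex1.IH) auto
  then show ?case by (auto simp: assms(1))
next
  case (All1 x \<phi>)
  have "\<And>i. i < length w \<Longrightarrow>
      sat w' (e(x := i)) E (subst_atoms g \<phi>) \<longleftrightarrow> sat w (e(x := i)) E \<phi>"
    using All1.prems by (intro All1.IH) auto
  then show ?case by (auto simp: assms(1))
qed (auto simp: assms(1))

lemma models_subst_atoms:
  assumes "length w' = length w" "formula_over \<tau> \<phi>" "fv \<phi> = {}"
    and "\<And>p xs e E. p \<in> \<tau> \<union> letter_preds \<Longrightarrow> length xs = arity p \<Longrightarrow>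
      \<forall>x\<in>set xs. e x < length w \<Longrightarrow> sat w' e E (g p xs) \<longleftrightarrow> holds w p (map e xs)"
  shows "models w' (subst_atoms g \<phi>) \<longleftrightarrow> models w \<phi>"
  unfolding models_def using assms by (intro sat_subst_atoms) auto

section \<open>Finite conjunctions and disjunctions with prescribed free variables\<close>

text \<open>The base formula supplies the free variables when the list is empty, as a substitution
  must not lose any.\<close>

definition Conjs :: "mso \<Rightarrow> mso list \<Rightarrow> mso" where
  "Conjs \<phi>0 \<phi>s = foldr Conj \<phi>s \<phi>0"

definition Disjs :: "mso \<Rightarrow> mso list \<Rightarrow> mso" where
  "Disjs \<phi>0 \<phi>s = foldr Disj \<phi>s \<phi>0"

lemma sat_Conjs: "sat w e E (Conjs \<phi>0 \<phi>s) \<longleftrightarrow> (\<forall>\<phi>\<in>set \<phi>s. sat w e E \<phi>) \<and> sat w e E \<phi>0"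
  by (induction \<phi>s) (auto simp: Conjs_def)

lemma sat_Disjs: "sat w e E (Disjs \<phi>0 \<phi>s) \<longleftrightarrow> (\<exists>\<phi>\<in>set \<phi>s. sat w e E \<phi>) \<or> sat w e E \<phi>0"
  by (induction \<phi>s) (auto simp: Disjs_def)

lemma fv_Conjs: "(\<forall>\<phi>\<in>set \<phi>s. fv \<phi> = S) \<Longrightarrow> fv \<phi>0 = S \<Longrightarrow> fv (Conjs \<phi>0 \<phi>s) = S"
  by (induction \<phi>s) (auto simp: Conjs_def)

lemma fv_Disjs: "(\<forall>\<phi>\<in>set \<phi>s. fv \<phi> = S) \<Longrightarrow> fv \<phi>0 = S \<Longrightarrow> fv (Disjs \<phi>0 \<phi>s) = S"
  by (induction \<phi>s) (auto simp: Disjs_def)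

lemma quantifier_free_Conjs:
  "(\<forall>\<phi>\<in>set \<phi>s. quantifier_free \<phi>) \<Longrightarrow> quantifier_free \<phi>0 \<Longrightarrow> quantifier_free (Conjs \<phi>0 \<phi>s)"
  by (induction \<phi>s) (auto simp: Conjs_def)

lemma quantifier_free_Disjs:
  "(\<forall>\<phi>\<in>set \<phi>s. quantifier_free \<phi>) \<Longrightarrow> quantifier_free \<phi>0 \<Longrightarrow> quantifier_free (Disjs \<phi>0 \<phi>s)"
  by (induction \<phi>s) (auto simp: Disjs_def)

lemma formula_over_Conjs:
  "formula_over \<tau> (Conjs \<phi>0 \<phi>s) \<longleftrightarrow> (\<forall>\<phi>\<in>set \<phi>s. formula_over \<tau> \<phi>) \<and> formula_over \<tau> \<phi>0"
  by (induction \<phi>s) (auto simp: Conjs_def)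

lemma formula_over_Disjs:
  "formula_over \<tau> (Disjs \<phi>0 \<phi>s) \<longleftrightarrow> (\<forall>\<phi>\<in>set \<phi>s. formula_over \<tau> \<phi>) \<and> formula_over \<tau> \<phi>0"
  by (induction \<phi>s) (auto simp: Disjs_def)

text \<open>Since substitutions preserve free variables, the truth values need a version with a
  free variable.\<close>

definition falsum :: "nat \<Rightarrow> mso" where
  "falsum x = Conj (Atom (LetterAt 0 0) [x]) (Neg (Atom (LetterAt 0 0) [x]))"

definition verum :: "nat \<Rightarrow> mso" where
  "verum x = Neg (falsum x)"

lemma falsum_simps [simp]:
  "fv (falsum x) = {Inl x}" "quantifier_free (falsum x)" "formula_over \<tau> (falsum x)"
  "\<not> sat w e E (falsum x)"
  by (auto simp: falsum_def letter_preds_def)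

lemma verum_simps [simp]:
  "fv (verum x) = {Inl x}" "quantifier_free (verum x)" "formula_over \<tau> (verum x)"
  "sat w e E (verum x)"
  by (auto simp: verum_def)

definition literal :: "bool \<Rightarrow> mso \<Rightarrow> mso" where
  "literal b \<phi> = (if b then \<phi> else Neg \<phi>)"

lemma literal_simps [simp]:
  "fv (literal b \<phi>) = fv \<phi>" "quantifier_free (literal b \<phi>) = quantifier_free \<phi>"
  "formula_over \<tau> (literal b \<phi>) = formula_over \<tau> \<phi>" "sat w e E (literal b \<phi>) = (sat w e E \<phi> = b)"
  by (auto simp: literal_def)


section \<open>Windows\<close>

definition window_letter :: "word \<Rightarrow> nat \<Rightarrow> letter" where
  "window_letter w i = prod_encode (list_encode w, i)"

definition window_word :: "letter \<Rightarrow> word" where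
  "window_word b = list_decode (fst (prod_decode b))"

definition window_index :: "letter \<Rightarrow> nat" where
  "window_index b = snd (prod_decode b)"

lemma window_word_letter [simp]: "window_word (window_letter w i) = w"
  by (simp add: window_word_def window_letter_def)

lemma window_index_letter [simp]: "window_index (window_letter w i) = i"
  by (simp add: window_index_def window_letter_def)

definition window_alphabet :: "letter set \<Rightarrow> nat \<Rightarrow> nat \<Rightarrow> letter set" where
  "window_alphabet A k d = (\<lambda>(w, i). window_letter w i) ` ({w \<in> lists A. length w \<le> k} \<times> {..<d})"

text \<open>Near the end of \<open>u\<close> the factor is shorter than \<open>k\<close>; this
  truncation shows that a position does not exist.\<close>

definition windows :: "nat \<Rightarrow> nat \<Rightarrow> word \<Rightarrow> word" where
  "windows k d u = map (\<lambda>x. window_letter (take k (drop x u)) (x mod d)) [0..<length u]"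

text \<open>The information accessible to the predicates without argument.\<close>

definition border :: "nat \<Rightarrow> nat \<Rightarrow> word \<Rightarrow> word \<times> word \<times> nat" where
  "border k d u = (take k u, take k (rev u), length u mod d)"

lemma length_windows [simp]: "length (windows k d u) = length u"
  by (simp add: windows_def)

lemma nth_windows [simp]:
  "x < length u \<Longrightarrow> windows k d u ! x = window_letter (take k (drop x u)) (x mod d)"
  by (simp add: windows_def)

lemma finite_lists_bounded: "finite A \<Longrightarrow> finite {w \<in> lists A. length w \<le> k}"
  using finite_lists_length_le[of A k] by (simp add: lists_eq_set)

lemma finite_window_alphabet: "finite A \<Longrightarrow> finite (window_alphabet A k d)"
  by (simp add: window_alphabet_def finite_lists_bounded)

lemma window_in_alphabet:
  assumes "u \<in> lists A" "0 < d"
  shows "window_letter (take k (drop x u)) (y mod d) \<in> window_alphabet A k d"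
proof -
  have "take k (drop x u) \<in> lists A"
    using assms(1) by (auto simp: lists_eq_set dest: in_set_takeD in_set_dropD)
  then show ?thesis using assms(2) by (force simp: window_alphabet_def)
qed

lemma windows_in_lists: "u \<in> lists A \<Longrightarrow> 0 < d \<Longrightarrow> windows k d u \<in> lists (window_alphabet A k d)"
  using window_in_alphabet[of u A d k] by (auto simp: windows_def)

lemma finite_borders:
  assumes "finite A" "0 < d"
  shows "finite (border k d ` lists A)"
proof (rule finite_subset)
  let ?W = "{w \<in> lists A. length w \<le> k}"
  show "border k d ` lists A \<subseteq> ?W \<times> ?W \<times> {..<d}"
    using assms(2) by (auto simp: border_def dest: in_set_takeD)
  show "finite (?W \<times> ?W \<times> {..<d})"
    using finite_lists_bounded[OF assms(1)] by auto
qed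


section \<open>Definability by windows\<close>

text \<open>\<open>K\<close> may depend on the border because predicates without argument, such as
  the length modulo \<open>d\<close>, need not be expressible in \<open>F\<close>. Fixing their
  values first turns them into truth constants.\<close>

definition window_definable ::
    "mso set \<Rightarrow> nat \<Rightarrow> nat \<Rightarrow> letter set \<Rightarrow> word set \<Rightarrow> bool" where
  "window_definable F k d A L \<longleftrightarrow> (\<exists>K. (\<forall>t. definable F (window_alphabet A k d) (K t)) \<and>
     (\<forall>u\<in>nonempty_words A. u \<in> L \<longleftrightarrow> windows k d u \<in> K (border k d u)))"

text \<open>A semantic substitute for \<open>MOD_of d\<close>. Unlike that set, it grows when
  \<open>d\<close> is replaced by a multiple, so the moduli of different atoms can be merged. The
  length 0 in the unary case is a dummy.\<close>

definition modular :: "nat \<Rightarrow> numpred \<Rightarrow> bool" where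
  "modular d P \<longleftrightarrow>
     np_arity P = 0 \<and> (\<forall>n. np_holds P n [] = np_holds P (n mod d) []) \<or>
     np_arity P = 1 \<and> (\<forall>n x. np_holds P n [x] = np_holds P 0 [x mod d])"

definition bounded_preds :: "numpred set \<Rightarrow> nat \<Rightarrow> nat \<Rightarrow> pred set" where
  "bounded_preds \<sigma> k d = Num ` \<sigma> \<union> Num ` {P. modular d P} \<union>
     {LetterAt a j | a j. j < k} \<union> {LetterFromMin a j | a j. j < k} \<union>
     {LetterFromMax a j | a j. j < k}"

lemma modular_MOD:
  assumes "d' dvd d"
  shows "modular d (mod_pos d' i)" "modular d (mod_len d' i)"
  unfolding modular_def mod_pos_def mod_len_def using mod_mod_cancel[OF assms] by simp_all

lemma modular_dvd:
  assumes "modular d P" "d dvd d'"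
  shows "modular d' P"
proof -
  have *: "n mod d' mod d = n mod d" for n
    using assms(2) by (rule mod_mod_cancel)
  show ?thesis
    using assms(1) unfolding modular_def by (metis *)
qed

lemma bounded_preds_mono:
  "k \<le> k' \<Longrightarrow> d dvd d' \<Longrightarrow> bounded_preds \<sigma> k d \<subseteq> bounded_preds \<sigma> k' d'"
  by (auto simp: bounded_preds_def intro: modular_dvd)

lemma letter_preds_bounded: "0 < k \<Longrightarrow> letter_preds \<subseteq> bounded_preds \<sigma> k d"
  by (auto simp: bounded_preds_def letter_preds_def)

text \<open>A formula has finitely many atoms, so a bound on the offsets and a common multiple of
  the moduli serve for all of them. \<open>D\<close> will be either all positive numbers or just 1;
  directedness keeps the common multiple inside \<open>D\<close>.\<close>

lemma formula_bounded:
  assumes directed: "\<forall>d\<in>D. \<forall>d'\<in>D. \<exists>e\<in>D. d dvd e \<and> d' dvd e" and "D \<noteq> {}"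
    and "formula_over (Num ` \<sigma> \<union> (plus_one \<union> (\<Union>d\<in>D. MOD_of d))) \<phi>"
  shows "\<exists>k>0. \<exists>d\<in>D. formula_over (bounded_preds \<sigma> k d) \<phi>"
proof -
  obtain d0 where "d0 \<in> D" using assms(2) by blast
  define bounded where
    "bounded \<phi> \<longleftrightarrow> (\<exists>k>0. \<exists>d\<in>D. formula_over (bounded_preds \<sigma> k d) \<phi>)" for \<phi>
  have boundedI: "bounded \<phi>" if "0 < k" "d \<in> D" "formula_over (bounded_preds \<sigma> k d) \<phi>" for k d \<phi>
    using that unfolding bounded_def by blast
  have join: "\<exists>k>0. \<exists>d\<in>D. formula_over (bounded_preds \<sigma> k d) \<phi> \<and> formula_over (bounded_preds \<sigma> k d) \<psi>"
    if "bounded \<phi>" "bounded \<psi>" for \<phi> \<psi>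
  proof -
    from that obtain k d k' d' where kd: "0 < k" "d \<in> D" "formula_over (bounded_preds \<sigma> k d) \<phi>"
      "d' \<in> D" "formula_over (bounded_preds \<sigma> k' d') \<psi>" unfolding bounded_def by blast
    then obtain e where e: "e \<in> D" "d dvd e" "d' dvd e" using directed by blast
    have "formula_over (bounded_preds \<sigma> (max k k') e) \<phi>"
      using e kd by (intro formula_over_mono[OF bounded_preds_mono kd(3)]) auto
    moreover have "formula_over (bounded_preds \<sigma> (max k k') e) \<psi>"
      using e kd by (intro formula_over_mono[OF bounded_preds_mono kd(5)]) auto
    ultimately show ?thesis using e(1) kd(1) by (meson less_max_iff_disj)
  qed
  have "bounded \<phi>"
    using assms(3)
  proof (induction \<phi>)
    case (Atom p xs)
    consider "p \<in> Num ` \<sigma>" | "p \<in> plus_one \<union> letter_preds" | d where "d \<in> D" "p \<in> MOD_of d"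
      using Atom by auto
    then obtain k d where "0 < k" "d \<in> D" "p \<in> bounded_preds \<sigma> k d"
    proof cases
      case 1
      then show ?thesis using that[OF zero_less_one \<open>d0 \<in> D\<close>] by (auto simp: bounded_preds_def)
    next
      case 2
      then obtain a k where "p = LetterAt a k \<or> p = LetterFromMin a k \<or> p = LetterFromMax a k"
        by (auto simp: plus_one_def letter_preds_def)
      then have "p \<in> bounded_preds \<sigma> (Suc k) d0"
        by (auto simp: bounded_preds_def)
      then show ?thesis using that \<open>d0 \<in> D\<close> by blast
    next
      case 3
      then have "p \<in> bounded_preds \<sigma> 1 d"
        using modular_MOD[OF dvd_refl] by (auto simp: bounded_preds_def MOD_of_def)
      then show ?thesis using that \<open>d \<in> D\<close> zero_less_one by blast
    qed
    then show ?case using Atom by (intro boundedI[of k d]) auto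
  next
    case (Conj \<phi> \<psi>)
    then obtain k d where "0 < k" "d \<in> D" "formula_over (bounded_preds \<sigma> k d) \<phi>"
      "formula_over (bounded_preds \<sigma> k d) \<psi>" using join[of \<phi> \<psi>] by auto
    then show ?case by (intro boundedI[of k d]) auto
  next
    case (Disj \<phi> \<psi>)
    then obtain k d where "0 < k" "d \<in> D" "formula_over (bounded_preds \<sigma> k d) \<phi>"
      "formula_over (bounded_preds \<sigma> k d) \<psi>" using join[of \<phi> \<psi>] by auto
    then show ?case by (intro boundedI[of k d]) auto
  next
    case FTrue
    show ?case by (rule boundedI[OF zero_less_one \<open>d0 \<in> D\<close>]) simp
  next
    case FFalse
    show ?case by (rule boundedI[OF zero_less_one \<open>d0 \<in> D\<close>]) simp
  next
    case (Mem x X)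
    show ?case by (rule boundedI[OF zero_less_one \<open>d0 \<in> D\<close>]) simp
  qed (simp_all add: bounded_def)
  then show ?thesis by (simp only: bounded_def)
qed


section \<open>Translating formulas on words into formulas on their windows\<close>

definition truth :: "bool \<Rightarrow> mso" where
  "truth b = (if b then FTrue else FFalse)"

lemma truth_simps [simp]:
  "fv (truth b) = {}" "quantifier_free (truth b)" "formula_over \<tau> (truth b)"
  "sat w e E (truth b) = b"
  by (auto simp: truth_def)

text \<open>Over the finite alphabet \<open>bs\<close>, this disjunction expresses any property
  \<open>Q\<close> of the letter at \<open>x\<close> by letter predicates alone. The other branch is
  a filler with the right free variables.\<close>

definition letters_at :: "letter list \<Rightarrow> (letter \<Rightarrow> bool) \<Rightarrow> nat list \<Rightarrow> mso" where
  "letters_at bs Q xs = (case xs of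
     [x] \<Rightarrow> Disjs (falsum x) (map (\<lambda>b. Atom (LetterAt b 0) [x]) (filter Q bs))
   | _ \<Rightarrow> Atom (LetterAt 0 0) xs)"

text \<open>Predicates of \<open>\<sigma>\<close> see only positions and the length, which windows
  preserve, so they are kept. A modular or local predicate with an argument is read off the letter
  there, and one without argument is evaluated on the border \<open>t\<close>.\<close>

primrec window_atom ::
    "numpred set \<Rightarrow> letter list \<Rightarrow> word \<times> word \<times> nat \<Rightarrow> pred \<Rightarrow> nat list \<Rightarrow> mso" where
  "window_atom \<sigma> bs t (Num P) xs =
     (if P \<in> \<sigma> then Atom (Num P) xs
      else if xs = [] then truth (np_holds P (snd (snd t)) [])
      else letters_at bs (\<lambda>b. np_holds P 0 [window_index b]) xs)"
| "window_atom \<sigma> bs t (LetterAt a j) xs =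
     letters_at bs (\<lambda>b. j < length (window_word b) \<and> window_word b ! j = a) xs"
| "window_atom \<sigma> bs t (LetterFromMin a j) xs =
     (if xs = [] then truth (j < length (fst t) \<and> fst t ! j = a) else Atom (LetterFromMin a j) xs)"
| "window_atom \<sigma> bs t (LetterFromMax a j) xs =
     (if xs = [] then truth (j < length (fst (snd t)) \<and> fst (snd t) ! j = a)
      else Atom (LetterFromMax a j) xs)"

lemma letters_at_simps:
  "quantifier_free (letters_at bs Q xs)" "fv (letters_at bs Q xs) = Inl ` set xs"
  "formula_over \<tau> (letters_at bs Q [x])"
  by (auto simp: letters_at_def quantifier_free_Disjs fv_Disjs formula_over_Disjs letter_preds_def
      split: list.split)

lemma sat_letters_at:
  assumes "e x < length v" "v ! e x \<in> set bs"
  shows "sat v e E (letters_at bs Q [x]) \<longleftrightarrow> Q (v ! e x)"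
  using assms by (auto simp: letters_at_def sat_Disjs)

lemma atom_map_window_atom: "atom_map (window_atom \<sigma> bs t)"
proof -
  have "quantifier_free (window_atom \<sigma> bs t p xs) \<and> fv (window_atom \<sigma> bs t p xs) = Inl ` set xs"
    for p xs
    by (cases p) (auto simp: letters_at_simps)
  then show ?thesis by (simp add: atom_map_def)
qed

lemma maps_into_window_atom:
  "maps_into (window_atom \<sigma> bs t) (Num ` \<sigma> \<union> (plus_one \<union> MOD_all)) (Num ` \<sigma>)"
  by (auto simp: maps_into_def plus_one_def MOD_all_def MOD_of_def mod_pos_def mod_len_def
      letter_preds_def length_Suc_conv letters_at_simps)

lemma sat_window_atom:
  assumes u: "u \<in> lists A" and d: "0 < d" and bs: "set bs = window_alphabet A k d"
    and p: "p \<in> bounded_preds \<sigma> k d" "length xs = arity p" and e: "\<forall>x\<in>set xs. e x < length u"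
  shows "sat (windows k d u) e E (window_atom \<sigma> bs (border k d u) p xs) \<longleftrightarrow> holds u p (map e xs)"
proof -
  have in_bs: "windows k d u ! x \<in> set bs" if "x < length u" for x
    using that window_in_alphabet[OF u d] bs by simp
  have *: "sat (windows k d u) e E (letters_at bs Q [x]) \<longleftrightarrow>
      Q (window_letter (take k (drop (e x) u)) (e x mod d))" if "e x < length u" for Q x
    using that in_bs by (subst sat_letters_at) auto
  show ?thesis
  proof (cases p)
    case (Num P)
    show ?thesis
    proof (cases "P \<in> \<sigma>")
      case False
      then have "modular d P" using p(1) Num by (auto simp: bounded_preds_def)
      then consider "np_arity P = 0" "\<forall>n. np_holds P n [] = np_holds P (n mod d) []"
        | "np_arity P = 1" "\<forall>n x. np_holds P n [x] = np_holds P 0 [x mod d]"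
        by (auto simp: modular_def)
      then show ?thesis
      proof cases
        case 1
        have "np_holds P (length u) [] = np_holds P (length u mod d) []" using 1 by blast
        then show ?thesis using 1 False p(2) Num by (simp add: border_def)
      next
        case 2
        then obtain x where "xs = [x]" using p(2) Num by (auto simp: length_Suc_conv)
        moreover have "np_holds P (length u) [e x] = np_holds P 0 [e x mod d]" using 2 by blast
        ultimately show ?thesis using False Num e by (simp add: *)
      qed
    qed (simp add: Num)
  next
    case (LetterAt a j)
    then obtain x where "xs = [x]" using p(2) by (auto simp: length_Suc_conv)
    \<comment> \<open>Membership in \<open>bounded_preds\<close> (or \<open>letter_preds\<close>
      through it) gives \<open>j < k\<close>, so the window at \<open>e x\<close> reaches the
      position asked for.\<close>
    then show ?thesis using LetterAt e p(1) by (auto simp: * bounded_preds_def)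
  next
    case (LetterFromMin a j)
    then show ?thesis using p by (auto simp: bounded_preds_def border_def)
  next
    case (LetterFromMax a j)
    then show ?thesis using p by (auto simp: bounded_preds_def border_def rev_nth)
  qed
qed

lemma enrichment_mono: "\<sigma>1 \<subseteq> \<sigma>2 \<Longrightarrow> enrichment \<sigma> F \<sigma>1 \<subseteq> enrichment \<sigma> F \<sigma>2"
proof -
  assume "\<sigma>1 \<subseteq> \<sigma>2"
  then have "qf_subst (Num ` \<sigma> \<union> \<sigma>2) \<phi> \<phi>'" if "qf_subst (Num ` \<sigma> \<union> \<sigma>1) \<phi> \<phi>'" for \<phi> \<phi>'
    using qf_subst_mono[OF that] by blast
  then have "(qf_subst (Num ` \<sigma> \<union> \<sigma>2))\<^sup>*\<^sup>* \<phi> \<phi>'" if "(qf_subst (Num ` \<sigma> \<union> \<sigma>1))\<^sup>*\<^sup>* \<phi> \<phi>'" for \<phi> \<phi>'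
    using that rtranclp_mono[of "qf_subst (Num ` \<sigma> \<union> \<sigma>1)" "qf_subst (Num ` \<sigma> \<union> \<sigma>2)"] by blast
  then show ?thesis by (auto simp: enrichment_def)
qed

locale logic_fragment =
  fixes \<sigma> :: "numpred set" and F :: "mso set"
  assumes fragment: "fragment \<sigma> F"
begin

lemma closed_formula: "\<phi> \<in> F \<Longrightarrow> formula_over (Num ` \<sigma>) \<phi> \<and> fv \<phi> = {}"
  using fragment by (auto simp: fragment_def closed_formulas_def)

lemma qf_substs_closed:
  "(qf_subst (Num ` \<sigma>))\<^sup>*\<^sup>* \<phi> \<phi>' \<Longrightarrow> \<phi> \<in> F \<Longrightarrow> \<phi>' \<in> F"
  by (induction rule: rtranclp_induct) (use fragment in \<open>auto simp: fragment_def\<close>)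

lemma Conj_closed: "\<phi> \<in> F \<Longrightarrow> \<psi> \<in> F \<Longrightarrow> Conj \<phi> \<psi> \<in> F"
  and Disj_closed: "\<phi> \<in> F \<Longrightarrow> \<psi> \<in> F \<Longrightarrow> Disj \<phi> \<psi> \<in> F"
  and truth_closed: "truth b \<in> F"
  using fragment by (auto simp: fragment_def closed_formulas_def)

lemma enrichment_closed_formula:
  assumes "\<phi>' \<in> enrichment \<sigma> F \<sigma>'"
  shows "formula_over (Num ` \<sigma> \<union> \<sigma>') \<phi>' \<and> fv \<phi>' = {}"
proof -
  obtain \<phi> where \<phi>: "\<phi> \<in> F" "(qf_subst (Num ` \<sigma> \<union> \<sigma>'))\<^sup>*\<^sup>* \<phi> \<phi>'"
    using assms by (auto simp: enrichment_def)
  have "formula_over (Num ` \<sigma> \<union> \<sigma>') \<phi> \<and> fv \<phi> = {}"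
    using closed_formula[OF \<phi>(1)] formula_over_mono[of "Num ` \<sigma>"] by blast
  with \<phi>(2) show ?thesis
    by (induction rule: rtranclp_induct) (auto simp: qf_subst_formula_over dest: qf_subst_fv)
qed

text \<open>The whole derivation of \<open>\<phi>'\<close> from some \<open>\<phi>\<close> in
  \<open>F\<close> is translated. Its steps become steps over \<open>\<sigma>\<close>, and its
  starting point \<open>subst_atoms g \<phi>\<close> is itself reached from \<open>\<phi>\<close> by
  such steps, so closure of \<open>F\<close> applies.\<close>

lemma subst_atoms_enrichment:
  assumes "\<phi>' \<in> enrichment \<sigma> F \<sigma>'"
    and g: "atom_map g" "maps_into g (Num ` \<sigma> \<union> \<sigma>') (Num ` \<sigma>)"
  shows "subst_atoms g \<phi>' \<in> F"
proof -
  obtain \<phi> where \<phi>: "\<phi> \<in> F" "(qf_subst (Num ` \<sigma> \<union> \<sigma>'))\<^sup>*\<^sup>* \<phi> \<phi>'"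
    using assms(1) by (auto simp: enrichment_def)
  have "formula_over (Num ` \<sigma> \<union> \<sigma>') \<phi>"
    using closed_formula[OF \<phi>(1)] formula_over_mono[of "Num ` \<sigma>"] by blast
  then have "subst_atoms g \<phi> \<in> F"
    using qf_substs_closed[OF qf_substs_subst_atoms[OF g] \<phi>(1)] by blast
  moreover have "(qf_subst (Num ` \<sigma>))\<^sup>*\<^sup>* (subst_atoms g \<phi>) (subst_atoms g \<phi>')"
    using \<phi>(2) qf_subst_subst_atoms[OF g] by (rule rtranclp_map)
  ultimately show ?thesis using qf_substs_closed by blast
qed

lemma window_definable_of_formula:
  assumes A: "finite A" and kd: "0 < k" "0 < d"
    and \<phi>: "\<phi> \<in> enrichment \<sigma> F (plus_one \<union> MOD_all)" "formula_over (bounded_preds \<sigma> k d) \<phi>"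
    and L: "L = {w \<in> nonempty_words A. models w \<phi>}"
  shows "window_definable F k d A L"
proof -
  let ?B = "window_alphabet A k d"
  obtain bs where bs: "set bs = ?B"
    using finite_list[OF finite_window_alphabet[OF A]] by blast
  \<comment> \<open>The border is a parameter of the translation, which gives one formula of
    \<open>F\<close> for each border.\<close>
  define K where "K t = {v \<in> lists ?B. models v (subst_atoms (window_atom \<sigma> bs t) \<phi>)}" for t
  have "definable F ?B (K t)" for t
    unfolding definable_def K_def
    using subst_atoms_enrichment[OF \<phi>(1) atom_map_window_atom maps_into_window_atom] by blast
  moreover have "u \<in> L \<longleftrightarrow> windows k d u \<in> K (border k d u)" if "u \<in> nonempty_words A" for u
  proof -
    have u: "u \<in> lists A" using that by (simp add: nonempty_words_def)
    have "models (windows k d u) (subst_atoms (window_atom \<sigma> bs (border k d u)) \<phi>) \<longleftrightarrow> models u \<phi>"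
    proof (rule models_subst_atoms[OF _ \<phi>(2)])
      show "fv \<phi> = {}" using enrichment_closed_formula[OF \<phi>(1)] by blast
    next
      fix p xs and e :: "nat \<Rightarrow> nat" and E
      assume "p \<in> bounded_preds \<sigma> k d \<union> letter_preds" "length xs = arity p"
        "\<forall>x\<in>set xs. e x < length u"
      then show "sat (windows k d u) e E (window_atom \<sigma> bs (border k d u) p xs) \<longleftrightarrow>
          holds u p (map e xs)"
        using sat_window_atom[OF u kd(2) bs] letter_preds_bounded[OF kd(1)] by blast
    qed simp
    then show ?thesis
      using that windows_in_lists[OF u kd(2)] by (simp add: L K_def)
  qed
  ultimately show ?thesis unfolding window_definable_def by blast
qed

lemma window_definable_of_definable_plus:
  assumes "finite A" "definable_plus (enrichment \<sigma> F (plus_one \<union> (\<Union>d\<in>D. MOD_of d))) A L"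
    and "\<forall>d\<in>D. \<forall>d'\<in>D. \<exists>e\<in>D. d dvd e \<and> d' dvd e" "D \<noteq> {}" "0 \<notin> D"
  shows "\<exists>k. \<exists>d\<in>D. window_definable F k d A L"
proof -
  obtain \<phi> where \<phi>: "\<phi> \<in> enrichment \<sigma> F (plus_one \<union> (\<Union>d\<in>D. MOD_of d))"
      "L = {w \<in> nonempty_words A. models w \<phi>}"
    using assms(2) by (auto simp: definable_plus_def)
  obtain k d where kd: "0 < k" "d \<in> D" "formula_over (bounded_preds \<sigma> k d) \<phi>"
    using formula_bounded[OF assms(3,4)] enrichment_closed_formula[OF \<phi>(1)] by blast
  have "0 < d" using kd(2) assms(5) by (cases d) auto
  have "D \<subseteq> {1..}" using assms(5) by (auto simp: Suc_le_eq intro: gr0I)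
  then have "plus_one \<union> (\<Union>d\<in>D. MOD_of d) \<subseteq> plus_one \<union> MOD_all"
    by (auto simp: MOD_all_def)
  then have "\<phi> \<in> enrichment \<sigma> F (plus_one \<union> MOD_all)"
    using enrichment_mono \<phi>(1) by blast
  from window_definable_of_formula[OF assms(1) kd(1) \<open>0 < d\<close> this kd(3) \<phi>(2)] kd(2)
  show ?thesis by blast
qed

end


section \<open>Expressing windows and borders by local and modular predicates\<close>

text \<open>\<open>P\<close> abstracts how letters of \<open>w\<close> are queried, so that factors,
  prefixes and reversed suffixes are treated alike. The answers also determine the length, because
  every existing position carries some letter of \<open>A\<close>.\<close>

lemma word_eq_iff_letters:
  assumes w: "w \<in> lists A" "w' \<in> lists A" "length w \<le> k" "length w' \<le> k"
    and P: "\<And>a j. j < k \<Longrightarrow> P a j \<longleftrightarrow> j < length w \<and> w ! j = a"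
  shows "w = w' \<longleftrightarrow> (\<forall>a\<in>A. \<forall>j<k. P a j \<longleftrightarrow> j < length w' \<and> w' ! j = a)"
proof
  assume "\<forall>a\<in>A. \<forall>j<k. P a j \<longleftrightarrow> j < length w' \<and> w' ! j = a"
  then have *: "(j < length w \<and> w ! j = a) \<longleftrightarrow> (j < length w' \<and> w' ! j = a)"
    if "a \<in> A" "j < k" for a j
    using P that by blast
  have 1: "j < length w' \<and> w' ! j = w ! j" if "j < length w" for j
  proof -
    have "w ! j \<in> A" "j < k"
      using that w nth_mem[OF that] by (auto simp: lists_eq_set)
    with that * show ?thesis by blast
  qed
  have 2: "j < length w" if "j < length w'" for j
  proof -
    have "w' ! j \<in> A" "j < k"
      using that w nth_mem[OF that] by (auto simp: lists_eq_set)
    with that * show ?thesis by blast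
  qed
  have "length w = length w'"
    using 1[of "length w'"] 2[of "length w"] by (meson less_irrefl linorder_neqE_nat)
  then show "w = w'" using 1 by (intro nth_equalityI) auto
qed (simp add: P)

lemma ball_atLeast0LessThan: "(\<forall>j\<in>{0..<k::nat}. P j) \<longleftrightarrow> (\<forall>j<k. P j)"
  by auto

text \<open>Modulus 1 carries no information. Giving it no predicates makes \<open>d = 1\<close> the
  case of local predicates alone, which the decidability claim refers to.\<close>

definition modulus_preds :: "nat \<Rightarrow> pred set" where
  "modulus_preds d = (if d = 1 then {} else MOD_of d)"

definition mod_formula :: "nat \<Rightarrow> nat \<Rightarrow> nat \<Rightarrow> mso" where
  "mod_formula d i x = (if d = 1 then verum x else Atom (Num (mod_pos d i)) [x])"

definition len_formula :: "nat \<Rightarrow> nat \<Rightarrow> mso" where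
  "len_formula d r = (if d = 1 then FTrue else Atom (Num (mod_len d r)) [])"

definition window_formula :: "letter list \<Rightarrow> nat \<Rightarrow> nat \<Rightarrow> letter \<Rightarrow> nat \<Rightarrow> mso" where
  "window_formula as k d b x = Conjs (mod_formula d (window_index b) x)
     [literal (j < length (window_word b) \<and> window_word b ! j = a) (Atom (LetterAt a j) [x]).
        a \<leftarrow> as, j \<leftarrow> [0..<k]]"

text \<open>A letter outside the window alphabet never occurs in a word of windows, so it translates
  to falsity. Inside the alphabet the residue is below \<open>d\<close>, and the corresponding
  modular predicate exists.\<close>

primrec unwindow_atom :: "letter list \<Rightarrow> nat \<Rightarrow> nat \<Rightarrow> pred \<Rightarrow> nat list \<Rightarrow> mso" where
  "unwindow_atom as k d (Num P) xs = Atom (Num P) xs"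
| "unwindow_atom as k d (LetterAt b j) xs = (case xs of
     [x] \<Rightarrow> if b \<in> window_alphabet (set as) k d then window_formula as k d b x else falsum x
   | _ \<Rightarrow> Atom (LetterAt b j) xs)"
| "unwindow_atom as k d (LetterFromMin b j) xs = Atom (LetterFromMin b j) xs"
| "unwindow_atom as k d (LetterFromMax b j) xs = Atom (LetterFromMax b j) xs"

primrec border_formula :: "letter list \<Rightarrow> nat \<Rightarrow> nat \<Rightarrow> word \<times> word \<times> nat \<Rightarrow> mso" where
  "border_formula as k d (p, t) = Conjs (len_formula d (snd t))
     ([literal (j < length p \<and> p ! j = a) (Atom (LetterFromMin a j) []). a \<leftarrow> as, j \<leftarrow> [0..<k]] @
      [literal (j < length (fst t) \<and> fst t ! j = a) (Atom (LetterFromMax a j) []).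
        a \<leftarrow> as, j \<leftarrow> [0..<k]])"

lemma window_formula_simps:
  "quantifier_free (window_formula as k d b x)" "fv (window_formula as k d b x) = {Inl x}"
  by (auto simp: window_formula_def mod_formula_def intro!: quantifier_free_Conjs fv_Conjs)

lemma formula_over_window_formula:
  assumes "window_index b < d"
  shows "formula_over (Num ` \<sigma> \<union> (plus_one \<union> modulus_preds d)) (window_formula as k d b x)"
proof -
  have "formula_over (Num ` \<sigma> \<union> (plus_one \<union> modulus_preds d)) (mod_formula d (window_index b) x)"
    using assms by (auto simp: mod_formula_def modulus_preds_def MOD_of_def mod_pos_def)
  then show ?thesis
    by (auto simp: window_formula_def formula_over_Conjs plus_one_def)
qed

lemma window_alphabetE:
  assumes "b \<in> window_alphabet A k d"
  obtains w i where "b = window_letter w i" "w \<in> lists A" "length w \<le> k" "i < d"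
  using assms by (auto simp: window_alphabet_def)

lemma window_index_less: "b \<in> window_alphabet A k d \<Longrightarrow> window_index b < d"
  by (auto simp: window_alphabet_def)

lemma window_letter_eq_iff [simp]: "window_letter w i = window_letter w' i' \<longleftrightarrow> w = w' \<and> i = i'"
  by (metis window_index_letter window_word_letter)

lemma sat_window_formula:
  assumes u: "u \<in> lists (set as)" and b: "b \<in> window_alphabet (set as) k d" and x: "e x < length u"
  shows "sat u e E (window_formula as k d b x) \<longleftrightarrow> windows k d u ! e x = b"
proof -
  obtain w i where b_eq: "b = window_letter w i" "w \<in> lists (set as)" "length w \<le> k" "i < d"
    using b by (rule window_alphabetE)
  let ?w = "take k (drop (e x) u)"
  have "?w \<in> lists (set as)"
    using u by (auto simp: lists_eq_set dest: in_set_takeD in_set_dropD)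
  then have "?w = w \<longleftrightarrow> (\<forall>a\<in>set as. \<forall>j<k. (e x + j < length u \<and> u ! (e x + j) = a) =
      (j < length w \<and> w ! j = a))"
    using b_eq x by (intro word_eq_iff_letters) auto
  moreover have "sat u e E (mod_formula d i x) \<longleftrightarrow> e x mod d = i"
    using b_eq(4) by (cases "d = 1") (simp_all add: mod_formula_def mod_pos_def)
  moreover have "sat u e E (window_formula as k d b x) \<longleftrightarrow> sat u e E (mod_formula d i x) \<and>
      (\<forall>a\<in>set as. \<forall>j<k. (e x + j < length u \<and> u ! (e x + j) = a) =
        (j < length w \<and> w ! j = a))"
    unfolding b_eq(1) by (simp add: window_formula_def sat_Conjs ball_atLeast0LessThan conj_commute)
  moreover have "windows k d u ! e x = b \<longleftrightarrow> ?w = w \<and> e x mod d = i"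
    using x by (simp add: b_eq(1))
  ultimately show ?thesis by blast
qed

lemma atom_map_unwindow_atom: "atom_map (unwindow_atom as k d)"
proof -
  have "quantifier_free (unwindow_atom as k d p xs) \<and> fv (unwindow_atom as k d p xs) = Inl ` set xs"
    for p xs
    by (cases p) (auto simp: window_formula_simps split: list.split)
  then show ?thesis by (simp add: atom_map_def)
qed

lemma maps_into_unwindow_atom:
  "maps_into (unwindow_atom as k d) (Num ` \<sigma>) (Num ` \<sigma> \<union> (plus_one \<union> modulus_preds d))"
proof -
  have "formula_over (Num ` \<sigma> \<union> (plus_one \<union> modulus_preds d)) (unwindow_atom as k d (LetterAt b j) [x])"
    for b j x
    using formula_over_window_formula[OF window_index_less] by simp
  then show ?thesis
    by (auto simp: maps_into_def letter_preds_def length_Suc_conv simp del: unwindow_atom.simps(2))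
qed

lemma sat_unwindow_atom:
  assumes u: "u \<in> lists (set as)" and d: "0 < d" and p: "p \<in> Num ` \<sigma> \<union> letter_preds"
    "length xs = arity p" "\<forall>x\<in>set xs. e x < length u"
  shows "sat u e E (unwindow_atom as k d p xs) \<longleftrightarrow> holds (windows k d u) p (map e xs)"
proof (cases "p \<in> letter_preds")
  case True
  then obtain b x where px: "p = LetterAt b 0" "xs = [x]"
    using p(2) by (auto simp: letter_preds_def length_Suc_conv)
  have "e x < length u" using p(3) px by simp
  moreover have "windows k d u ! e x \<in> window_alphabet (set as) k d"
    using calculation window_in_alphabet[OF u d] by simp
  ultimately show ?thesis
    using sat_window_formula[OF u, of "windows k d u ! e x"] sat_window_formula[OF u, of b] px
    by (simp del: nth_windows) blast
qed (use p in auto)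

lemma border_formula_simps:
  "quantifier_free (border_formula as k d t)" "fv (border_formula as k d t) = {}"
  by (cases t; auto simp: len_formula_def intro!: quantifier_free_Conjs fv_Conjs)+

lemma formula_over_border_formula:
  assumes "snd (snd t) < d"
  shows "formula_over (Num ` \<sigma> \<union> (plus_one \<union> modulus_preds d)) (border_formula as k d t)"
proof -
  have "formula_over (Num ` \<sigma> \<union> (plus_one \<union> modulus_preds d)) (len_formula d (snd (snd t)))"
    using assms by (auto simp: len_formula_def modulus_preds_def MOD_of_def mod_len_def)
  then show ?thesis
    by (cases t) (auto simp: formula_over_Conjs plus_one_def)
qed

lemma sat_border_formula:
  assumes u: "u \<in> lists (set as)" and v: "v \<in> lists (set as)"
  shows "sat u e E (border_formula as k d (border k d v)) \<longleftrightarrow> border k d u = border k d v"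
proof -
  have lists: "take k w \<in> lists (set as)" "take k (rev w) \<in> lists (set as)"
    if "w \<in> lists (set as)" for w
    using that set_take_subset[of k w] set_take_subset[of k "rev w"] by (auto simp: lists_eq_set)
  have "sat u e E (len_formula d (length v mod d)) \<longleftrightarrow> length u mod d = length v mod d"
    by (auto simp: len_formula_def mod_len_def)
  moreover have "take k u = take k v \<longleftrightarrow> (\<forall>a\<in>set as. \<forall>j<k.
      (j < length u \<and> u ! j = a) = (j < length (take k v) \<and> take k v ! j = a))"
    using lists[OF u] lists[OF v] by (intro word_eq_iff_letters) auto
  moreover have "take k (rev u) = take k (rev v) \<longleftrightarrow> (\<forall>a\<in>set as. \<forall>j<k.
      (j < length u \<and> u ! (length u - 1 - j) = a) =
      (j < length (take k (rev v)) \<and> take k (rev v) ! j = a))"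
    using lists[OF u] lists[OF v] by (intro word_eq_iff_letters) (auto simp: rev_nth)
  moreover have "sat u e E (border_formula as k d (border k d v)) \<longleftrightarrow>
      sat u e E (len_formula d (length v mod d)) \<and>
      (\<forall>a\<in>set as. \<forall>j<k. (j < length u \<and> u ! j = a) =
        (j < length (take k v) \<and> take k v ! j = a)) \<and>
      (\<forall>a\<in>set as. \<forall>j<k. (j < length u \<and> u ! (length u - 1 - j) = a) =
        (j < length (take k (rev v)) \<and> take k (rev v) ! j = a))"
    by (simp add: border_def sat_Conjs ball_Un ball_atLeast0LessThan conj_ac)
  ultimately show ?thesis
    unfolding border_def prod.inject by blast
qed

context logic_fragment
begin

text \<open>Only finitely many borders occur, so one can take a disjunction over them, each case
  joining a description of the border to the translated formula of \<open>F\<close>.\<close>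

lemma definable_plus_of_window_definable:
  assumes A: "finite A" and d: "0 < d" and L: "L \<subseteq> nonempty_words A" "window_definable F k d A L"
  shows "definable_plus (enrichment \<sigma> F (plus_one \<union> modulus_preds d)) A L"
proof -
  let ?B = "window_alphabet A k d" and ?\<tau> = "Num ` \<sigma> \<union> (plus_one \<union> modulus_preds d)"
  obtain as where as: "set as = A" using finite_list[OF A] by blast
  obtain K where K: "\<And>t. definable F ?B (K t)"
      "\<And>u. u \<in> nonempty_words A \<Longrightarrow> u \<in> L \<longleftrightarrow> windows k d u \<in> K (border k d u)"
    using L(2) unfolding window_definable_def by blast
  have "\<forall>t. \<exists>\<psi>. \<psi> \<in> F \<and> K t = {v \<in> lists ?B. models v \<psi>}"
    using K(1) unfolding definable_def by blast
  then obtain \<psi> where \<psi>: "\<And>t. \<psi> t \<in> F" "\<And>t. K t = {v \<in> lists ?B. models v (\<psi> t)}"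
    by metis
  obtain ts where ts: "set ts = border k d ` lists A"
    using finite_list[OF finite_borders[OF A d]] by blast
  let ?g = "unwindow_atom as k d"
  define \<phi> where "\<phi> = Disjs FFalse (map (\<lambda>t. Conj (border_formula as k d t) (subst_atoms ?g (\<psi> t))) ts)"
  \<comment> \<open>Membership in the enrichment needs a formula of \<open>F\<close> to start from.
    It has the same shape, with \<open>FTrue\<close> as a placeholder for each border formula; the
    latter is closed and quantifier-free and may therefore be substituted.\<close>
  have "Disjs FFalse (map (\<lambda>t. Conj FTrue (\<psi> t)) ts') \<in> F" for ts'
    using \<psi>(1) truth_closed[of False] truth_closed[of True]
    by (induction ts') (simp_all add: Disjs_def truth_def Conj_closed Disj_closed)
  moreover have "(qf_subst ?\<tau>)\<^sup>*\<^sup>* (Disjs FFalse (map (\<lambda>t. Conj FTrue (\<psi> t)) ts'))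
      (Disjs FFalse (map (\<lambda>t. Conj (border_formula as k d t) (subst_atoms ?g (\<psi> t))) ts'))"
    if "set ts' \<subseteq> set ts" for ts'
    using that
  proof (induction ts')
    case (Cons t ts')
    have "snd (snd t) < d"
      using Cons.prems d by (auto simp: ts border_def)
    then have "(qf_subst ?\<tau>)\<^sup>*\<^sup>* FTrue (border_formula as k d t)"
      by (intro r_into_rtranclp qf_subst.replace)
        (auto simp: border_formula_simps formula_over_border_formula)
    moreover have "(qf_subst ?\<tau>)\<^sup>*\<^sup>* (\<psi> t) (subst_atoms ?g (\<psi> t))"
      using closed_formula[OF \<psi>(1)[of t]]
      by (intro qf_substs_subst_atoms[OF atom_map_unwindow_atom maps_into_unwindow_atom]) simp
    ultimately show ?case
      using Cons by (auto simp: Disjs_def intro!: qf_substs_Disj qf_substs_Conj)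
  qed (simp add: Disjs_def)
  ultimately have "\<phi> \<in> enrichment \<sigma> F (plus_one \<union> modulus_preds d)"
    unfolding enrichment_def \<phi>_def by blast
  moreover have "models u \<phi> \<longleftrightarrow> u \<in> L" if "u \<in> nonempty_words A" for u
  proof -
    have u: "u \<in> lists (set as)" using that by (simp add: nonempty_words_def as)
    have "models u (subst_atoms ?g (\<psi> t)) \<longleftrightarrow> models (windows k d u) (\<psi> t)" for t
      using closed_formula[OF \<psi>(1)[of t]] sat_unwindow_atom[OF u d]
      by (intro models_subst_atoms[where \<tau> = "Num ` \<sigma>"]) auto
    then have "models u \<phi> \<longleftrightarrow> (\<exists>v\<in>lists A. border k d u = border k d v \<and>
        models (windows k d u) (\<psi> (border k d v)))"
      using sat_border_formula[OF u] by (auto simp: models_def \<phi>_def sat_Disjs ts as)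
    also have "\<dots> \<longleftrightarrow> windows k d u \<in> K (border k d u)"
      using u windows_in_lists[OF _ d, of u A k] by (auto simp: as \<psi>(2))
    finally show ?thesis using K(2)[OF that] by simp
  qed
  ultimately show ?thesis
    using L(1) unfolding definable_plus_def by blast
qed

end


section \<open>Closure properties coming from the variety\<close>

locale logic_variety = logic_fragment +
  fixes V :: "nat monoid set"
  assumes variety: "monoid_variety V"
    and equivalent: "equivalent_to_variety F V"
    and not_groups: "\<not> variety_of_groups V"
begin

lemma definable_iff_recognizes:
  "finite A \<Longrightarrow> definable F A L \<longleftrightarrow> (\<exists>M\<in>V. recognizes M A L)"
  using equivalent by (auto simp: equivalent_to_variety_def)

text \<open>Composing the recognizing morphism with the one given by \<open>g\<close> leaves the
  monoid unchanged. As recognition is by monoids, \<open>g\<close> may send letters to words of any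
  length, including the empty word.\<close>

lemma definable_inverse_morphism:
  assumes "definable F B K" "finite B" "finite B'" and g: "\<And>b. b \<in> B' \<Longrightarrow> g b \<in> lists B"
  shows "definable F B' {v \<in> lists B'. concat (map g v) \<in> K}"
proof -
  obtain M h P where M: "M \<in> V" and h: "h \<in> monoid_hom (free_monoid B) M" "P \<subseteq> carrier M"
      and K: "K = {w \<in> lists B. h w \<in> P}"
    using assms(1,2) by (auto simp: definable_iff_recognizes recognizes_def)
  have g_lists: "concat (map g v) \<in> lists B" if "v \<in> lists B'" for v
    using that g by (induction v) auto
  have "(\<lambda>v. h (concat (map g v))) \<in> monoid_hom (free_monoid B') M"
    using h(1) g_lists by (auto simp: monoid_hom_def hom_def free_monoid_def Pi_iff)
  moreover have "{v \<in> lists B'. concat (map g v) \<in> K} = {v \<in> lists B'. h (concat (map g v)) \<in> P}"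
    using g_lists unfolding K by blast
  ultimately have "recognizes M B' {v \<in> lists B'. concat (map g v) \<in> K}"
    unfolding recognizes_def
    by (intro bexI[of _ "\<lambda>v. h (concat (map g v))"] exI[of _ P]) (simp_all add: h(2))
  then show ?thesis using M assms(3) by (auto simp: definable_iff_recognizes)
qed

lemma definable_letter_map:
  assumes "definable F B K" "finite B" "finite B'" "\<And>b. b \<in> B' \<Longrightarrow> g b \<in> B"
  shows "definable F B' {v \<in> lists B'. map g v \<in> K}"
  using definable_inverse_morphism[OF assms(1-3), of "\<lambda>b. [g b]"] assms(4) by simp

lemma definable_Int:
  assumes "definable F B K" "definable F B K'"
  shows "definable F B (K \<inter> K')"
proof -
  obtain \<phi> \<psi> where "\<phi> \<in> F" "K = {w \<in> lists B. models w \<phi>}" "\<psi> \<in> F" "K' = {w \<in> lists B. models w \<psi>}"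
    using assms by (auto simp: definable_def)
  then show ?thesis
    unfolding definable_def by (intro bexI[of _ "Conj \<phi> \<psi>"]) (auto simp: models_def intro: Conj_closed)
qed

lemma definable_empty: "definable F B {}"
  using truth_closed[of False] unfolding definable_def
  by (intro bexI[of _ "truth False"]) (auto simp: models_def)

lemma monoid_member: "M \<in> V \<Longrightarrow> monoid M"
  using variety unfolding monoid_variety_def finite_monoid_def by blast

text \<open>If every element had a positive power equal to the identity, the preceding power would
  be an inverse and every \<open>M\<close> in \<open>V\<close> a group.\<close>

lemma non_invertible_element:
  obtains M x where "M \<in> V" "x \<in> carrier M" "\<And>n. 0 < n \<Longrightarrow> x [^]\<^bsub>M\<^esub> (n::nat) \<noteq> \<one>\<^bsub>M\<^esub>"
proof -
  obtain M where M: "M \<in> V" "\<not> group M"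
    using variety not_groups unfolding variety_of_groups_def by blast
  interpret monoid M using M(1) by (rule monoid_member)
  have "\<exists>x\<in>carrier M. \<forall>n>0. x [^]\<^bsub>M\<^esub> (n::nat) \<noteq> \<one>\<^bsub>M\<^esub>"
  proof (rule ccontr)
    assume *: "\<not> ?thesis"
    have "group M"
    proof (rule group_l_invI)
      fix x assume x: "x \<in> carrier M"
      then obtain n :: nat where "0 < n" "x [^]\<^bsub>M\<^esub> n = \<one>\<^bsub>M\<^esub>" using * by blast
      then have "x [^]\<^bsub>M\<^esub> (n - 1) \<otimes>\<^bsub>M\<^esub> x = \<one>\<^bsub>M\<^esub>"
        by (cases n) auto
      then show "\<exists>y\<in>carrier M. y \<otimes>\<^bsub>M\<^esub> x = \<one>\<^bsub>M\<^esub>" using x by blast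
    qed
    then show False using M(2) by blast
  qed
  then show ?thesis using that M(1) by blast
qed

text \<open>A morphism to a monoid of \<open>V\<close> that is not a group sees whether a bad letter occurs.\<close>

lemma definable_all_letters:
  assumes "finite B"
  shows "definable F B {v \<in> lists B. \<forall>b\<in>set v. Q b}"
proof -
  obtain M x where M: "M \<in> V" and x: "x \<in> carrier M"
      and non_inv: "\<And>n. 0 < n \<Longrightarrow> x [^]\<^bsub>M\<^esub> (n::nat) \<noteq> \<one>\<^bsub>M\<^esub>"
    using non_invertible_element by blast
  interpret monoid M using M by (rule monoid_member)
  \<comment> \<open>Each bad letter contributes a factor \<open>x\<close> and each good one the
    identity; no positive power of \<open>x\<close> is the identity.\<close>
  define h where "h v = x [^]\<^bsub>M\<^esub> length (filter (\<lambda>b. \<not> Q b) v)" for v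
  have "h \<in> monoid_hom (free_monoid B) M"
    using x by (auto simp: h_def monoid_hom_def hom_def free_monoid_def nat_pow_mult)
  moreover have "h v \<in> {\<one>\<^bsub>M\<^esub>} \<longleftrightarrow> (\<forall>b\<in>set v. Q b)" for v
  proof
    assume "h v \<in> {\<one>\<^bsub>M\<^esub>}"
    then have "length (filter (\<lambda>b. \<not> Q b) v) = 0"
      using non_inv[of "length (filter (\<lambda>b. \<not> Q b) v)"] by (auto simp: h_def)
    then show "\<forall>b\<in>set v. Q b" by (simp add: filter_empty_conv)
  next
    assume "\<forall>b\<in>set v. Q b"
    then have "filter (\<lambda>b. \<not> Q b) v = []" by (simp add: filter_empty_conv)
    then show "h v \<in> {\<one>\<^bsub>M\<^esub>}" by (simp add: h_def)
  qed
  ultimately have "recognizes M B {v \<in> lists B. \<forall>b\<in>set v. Q b}"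
    unfolding recognizes_def by (intro bexI[of _ h] exI[of _ "{\<one>\<^bsub>M\<^esub>}"]) auto
  then show ?thesis using M assms by (auto simp: definable_iff_recognizes)
qed

text \<open>Reducing residues modulo \<open>s\<close> is a letter-to-letter map from windows modulo
  \<open>d\<close> to windows modulo \<open>s\<close>.\<close>

lemma window_definable_dvd:
  assumes "window_definable F k s A L" "finite A" "0 < s" "0 < d" "s dvd d"
  shows "window_definable F k d A L"
proof -
  let ?B = "window_alphabet A k s" and ?B' = "window_alphabet A k d"
  obtain K where K: "\<And>t. definable F ?B (K t)"
      "\<And>u. u \<in> nonempty_words A \<Longrightarrow> u \<in> L \<longleftrightarrow> windows k s u \<in> K (border k s u)"
    using assms(1) unfolding window_definable_def by blast
  define g where "g b = window_letter (window_word b) (window_index b mod s)" for b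
  define G where "G t = (case t of (p :: word, q :: word, r) \<Rightarrow> (p, q, r mod s))" for t
  define K' where "K' t = {v \<in> lists ?B'. map g v \<in> K (G t)}" for t
  have "g b \<in> ?B" if "b \<in> ?B'" for b
    using that assms(3) by (auto simp: g_def window_alphabet_def)
  then have "definable F ?B' (K' t)" for t
    unfolding K'_def using K(1) assms(2)
    by (intro definable_letter_map[where B = ?B]) (auto intro: finite_window_alphabet)
  moreover have "u \<in> L \<longleftrightarrow> windows k d u \<in> K' (border k d u)" if "u \<in> nonempty_words A" for u
  proof -
    have "map g (windows k d u) = windows k s u"
      using assms(5) by (intro nth_equalityI) (auto simp: g_def mod_mod_cancel)
    moreover have "G (border k d u) = border k s u"
      using assms(5) by (auto simp: G_def border_def mod_mod_cancel)
    moreover have "windows k d u \<in> lists ?B'"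
      using that assms(4) by (intro windows_in_lists) (auto simp: nonempty_words_def)
    ultimately show ?thesis using K(2)[OF that] by (simp add: K'_def)
  qed
  ultimately show ?thesis unfolding window_definable_def by blast
qed

end


section \<open>Stretching words\<close>

lemma drop_windows:
  assumes "d dvd m"
  shows "drop m (windows k d u) = windows k d (drop m u)"
  using assms by (intro nth_equalityI) (auto simp: add.commute[of m] elim!: dvdE)

text \<open>Windows at the first \<open>n\<close> positions extend at most \<open>k\<close> letters
  further. Equality of the longer prefixes also makes truncation at the end agree.\<close>

lemma take_windows:
  assumes "take (n + k) v = take (n + k) v'"
  shows "take n (windows k d v) = take n (windows k d v')"
proof -
  have min: "min (length v) (n + k) = min (length v') (n + k)"
    using arg_cong[OF assms, of length] by (simp add: min.commute)
  have "take k (drop x v) = take k (drop x v')" if "x < n" for x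
  proof -
    have "take k (drop x v) = take k (drop x (take (n + k) v))"
      using that by (simp add: drop_take min_def)
    also have "\<dots> = take k (drop x v')"
      using that by (simp add: assms drop_take min_def)
    finally show ?thesis .
  qed
  then show ?thesis
    using min by (intro nth_equalityI) auto
qed

text \<open>The incomplete last block is left unchanged. When \<open>f\<close> produces words of
  length \<open>d \<ge> s\<close>, the length modulo \<open>s\<close> thus survives as the length
  modulo \<open>d\<close>.\<close>

function stretch :: "nat \<Rightarrow> (word \<Rightarrow> word) \<Rightarrow> word \<Rightarrow> word" where
  "stretch s f u = (if s = 0 \<or> length u < s then u else f (take s u) @ stretch s f (drop s u))"
  by auto
termination by (relation "measure (\<lambda>(s, f, u). length u)") auto

declare stretch.simps [simp del]

lemma syntactic_congruence_append:
  assumes "(u, u') \<in> syntactic_congruence A L" "(v, v') \<in> syntactic_congruence A L"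
  shows "(u @ v, u' @ v') \<in> syntactic_congruence A L"
proof -
  have lists: "u \<in> lists A" "u' \<in> lists A" "v \<in> lists A" "v' \<in> lists A"
    using assms by (auto simp: syntactic_congruence_def)
  have "x @ (u @ v) @ y \<in> L \<longleftrightarrow> x @ (u' @ v') @ y \<in> L" if "x \<in> lists A" "y \<in> lists A" for x y
  proof -
    have "x @ u @ (v @ y) \<in> L \<longleftrightarrow> x @ u' @ (v @ y) \<in> L"
      using assms(1) that lists append_in_lists_conv[of v y A]
      unfolding syntactic_congruence_def by blast
    moreover have "(x @ u') @ v @ y \<in> L \<longleftrightarrow> (x @ u') @ v' @ y \<in> L"
      using assms(2) that lists append_in_lists_conv[of x u' A]
      unfolding syntactic_congruence_def by blast
    ultimately show ?thesis by simp
  qed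
  then show ?thesis using lists by (simp add: syntactic_congruence_def)
qed

locale block_map =
  fixes A :: "letter set" and s d :: nat and f :: "word \<Rightarrow> word"
  assumes s_pos: "0 < s" and s_le_d: "s \<le> d"
    and f_lists: "\<And>u. u \<in> lists A \<Longrightarrow> length u = s \<Longrightarrow> f u \<in> lists A"
    and f_length: "\<And>u. u \<in> lists A \<Longrightarrow> length u = s \<Longrightarrow> length (f u) = d"
begin

abbreviation stretched :: "word \<Rightarrow> word" where
  "stretched \<equiv> stretch s f"

lemma d_pos: "0 < d"
  using s_pos s_le_d by simp

lemma stretched_short: "length u < s \<Longrightarrow> stretched u = u"
  by (simp add: stretch.simps)

lemma stretched_block: "s \<le> length u \<Longrightarrow> stretched u = f (take s u) @ stretched (drop s u)"
  using s_pos by (subst stretch.simps) auto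

lemma take_drop_lists: "u \<in> lists A \<Longrightarrow> take n u \<in> lists A" "u \<in> lists A \<Longrightarrow> drop n u \<in> lists A"
  by (auto simp: lists_eq_set dest: in_set_takeD in_set_dropD)

lemma stretch_induct [consumes 1, case_names short block]:
  assumes "u \<in> lists A"
    and "\<And>u. u \<in> lists A \<Longrightarrow> length u < s \<Longrightarrow> P u"
    and "\<And>u. u \<in> lists A \<Longrightarrow> s \<le> length u \<Longrightarrow> P (drop s u) \<Longrightarrow> P u"
  shows "P u"
  using assms(1)
proof (induction u rule: measure_induct_rule[where f = length])
  case (less u)
  then show ?case
    using assms(2,3)[of u] s_pos take_drop_lists(2)[of u s] by (cases "length u < s") auto
qed

lemma f_block: "u \<in> lists A \<Longrightarrow> s \<le> length u \<Longrightarrow> f (take s u) \<in> lists A \<and> length (f (take s u)) = d"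
  using f_lists[of "take s u"] f_length[of "take s u"] take_drop_lists(1)[of u s] by auto

lemma stretched_lists: "u \<in> lists A \<Longrightarrow> stretched u \<in> lists A"
  by (induction rule: stretch_induct) (auto simp: stretched_short stretched_block f_block)

lemma length_stretched_mod: "u \<in> lists A \<Longrightarrow> length (stretched u) mod d = length u mod s"
proof (induction rule: stretch_induct)
  case (short u)
  then show ?case using s_le_d by (simp add: stretched_short)
next
  case (block u)
  then show ?case
    by (simp add: stretched_block f_block mod_if[of "length u" s] s_pos)
qed

lemma length_stretched_ge: "u \<in> lists A \<Longrightarrow> length u \<le> length (stretched u)"
proof (induction rule: stretch_induct)
  case (block u)
  then show ?case using f_block[of u] s_le_d by (simp add: stretched_block)
qed (simp add: stretched_short)

text \<open>Cutting after \<open>m\<close> blocks respects block boundaries, and the kept blocks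
  already produce \<open>m * d\<close> letters unless the word ends before.\<close>

lemma take_stretched:
  assumes "u \<in> lists A" "n \<le> m * d"
  shows "take n (stretched (take (m * s) u)) = take n (stretched u)"
  using assms
proof (induction m arbitrary: u n)
  case (Suc m)
  show ?case
  proof (cases "length u < s")
    case False
    let ?v = "take (Suc m * s) u"
    have v: "s \<le> length ?v" "take s ?v = take s u" "drop s ?v = take (m * s) (drop s u)"
      using False by (auto simp: min_def drop_take)
    have "take (n - d) (stretched (take (m * s) (drop s u))) = take (n - d) (stretched (drop s u))"
      using Suc.prems take_drop_lists by (intro Suc.IH) auto
    then show ?thesis
      using False f_block[OF Suc.prems(1)] stretched_block[of u] stretched_block[OF v(1)]
      unfolding v(2,3) by simp
  qed simp
qed simp

lemma stretched_append:
  assumes "v \<in> lists A" "s dvd length v" "w \<in> lists A"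
  shows "stretched (v @ w) = stretched v @ stretched w"
  using assms(1,2)
proof (induction rule: stretch_induct)
  case (short u)
  then have "u = []" by (auto dest: dvd_imp_le)
  then show ?case using s_pos by (simp add: stretched_short)
next
  case (block u)
  then show ?case by (simp add: stretched_block dvd_diff_nat)
qed

text \<open>The letter at the start of a block emits the windows at all positions of the image of
  that block, and the other letters emit nothing. This makes the passage to the windows of the
  stretched word a morphism.\<close>

definition chunk :: "nat \<Rightarrow> letter \<Rightarrow> word" where
  "chunk k b = (if window_index b = 0 then take d (windows k d (stretched (window_word b))) else [])"

lemma windows_stretched:
  "u \<in> lists A \<Longrightarrow> concat (map (chunk k) (windows ((k + 2) * s) s u)) = windows k d (stretched u)"
proof (induction u rule: measure_induct_rule[where f = length])
  case (less u)
  let ?K = "(k + 2) * s"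
  show ?case
  proof (cases "u = []")
    case True
    then show ?thesis using s_pos by (simp add: windows_def stretched_short)
  next
    case False
    let ?W = "windows ?K s u"
    \<comment> \<open>Inside a block the residue modulo \<open>s\<close> is not 0, so only the first
      letter contributes.\<close>
    have "chunk k (?W ! Suc x) = []" if "Suc x < length u" "Suc x < s" for x
      using that by (simp add: chunk_def)
    then have "concat (map (chunk k) (tl (take s ?W))) = []"
      by (auto simp: in_set_conv_nth nth_tl)
    moreover have W: "take s ?W = ?W ! 0 # tl (take s ?W)"
      using False s_pos by (intro nth_equalityI) (auto simp: nth_Cons nth_tl split: nat.split)
    ultimately have "concat (map (chunk k) (take s ?W)) = chunk k (?W ! 0)"
      by (metis append_Nil2 concat.simps(2) list.map(2))
    also have "\<dots> = take d (windows k d (stretched (take ?K u)))"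
      using False by (simp add: chunk_def)
    also have "\<dots> = take d (windows k d (stretched u))"
    proof (rule take_windows)
      \<comment> \<open>The windows of one image block depend on \<open>d + k\<close> letters of the
        stretched word, which is at most \<open>(k + 2) * d\<close>. Hence \<open>k + 2\<close>
        blocks of \<open>u\<close> suffice, which explains the window length
        \<open>(k + 2) * s\<close>.\<close>
      have "k \<le> (k + 1) * d" using d_pos by (cases d) auto
      then show "take (d + k) (stretched (take ?K u)) = take (d + k) (stretched u)"
        using less.prems by (intro take_stretched) auto
    qed
    finally have "concat (map (chunk k) (take s ?W)) = take d (windows k d (stretched u))" .
    moreover have "concat (map (chunk k) (drop s ?W)) = drop d (windows k d (stretched u))"
    proof -
      have "stretched (drop s u) = drop d (stretched u)"
      proof (cases "length u < s")
        case True
        then show ?thesis using s_le_d s_pos by (simp add: stretched_short)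
      next
        case False
        then show ?thesis using f_block[OF less.prems] by (simp add: stretched_block[of u])
      qed
      then show ?thesis
        using False s_pos less take_drop_lists(2)[of u s] by (simp add: drop_windows)
    qed
    ultimately have "concat (map (chunk k) (take s ?W @ drop s ?W)) =
        take d (windows k d (stretched u)) @ drop d (windows k d (stretched u))"
      by (simp only: map_append concat_append)
    then show ?thesis by (simp only: append_take_drop_id)
  qed
qed

text \<open>Blocks are counted from the left, so the suffix must be cut at a block boundary before
  it is stretched. A suffix shorter than the window length is the whole word; otherwise its last
  \<open>(k + 1) * s + r\<close> letters start at a boundary, \<open>r\<close> being the length
  modulo \<open>s\<close>.\<close>

definition stretched_border :: "nat \<Rightarrow> word \<times> word \<times> nat \<Rightarrow> word \<times> word \<times> nat" where
  "stretched_border k t = (case t of (p, q, r) \<Rightarrow>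
     (take k (stretched p),
      take k (rev (stretched (rev (if length q < (k + 2) * s then q else take ((k + 1) * s + r) q)))),
      r))"

lemma border_stretched:
  assumes u: "u \<in> lists A"
  shows "border k d (stretched u) = stretched_border k (border ((k + 2) * s) s u)"
proof -
  let ?K = "(k + 2) * s" and ?r = "length u mod s"
  have k_le: "k \<le> (k + 1) * s" "k \<le> (k + 2) * d" using s_pos d_pos by (cases s; cases d; simp)+
  have "take k (stretched u) = take k (stretched (take ?K u))"
    using u k_le(2) by (intro take_stretched[symmetric]) auto
  moreover have "take k (rev (stretched u)) = take k (rev (stretched (rev
      (if length (take ?K (rev u)) < ?K then take ?K (rev u)
       else take ((k + 1) * s + ?r) (take ?K (rev u))))))"
  proof (cases "length u < ?K")
    case False
    \<comment> \<open>A suffix of length \<open>m\<close> is short enough to be contained in the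
      border since \<open>?r < s\<close>, starts at a block boundary, and has at least
      \<open>k\<close> letters, so its stretching determines the last \<open>k\<close>
      letters.\<close>
    define m where "m = (k + 1) * s + ?r"
    have r: "?r < s" using s_pos by simp
    then have m: "m \<le> ?K" "m \<le> length u" using False by (auto simp: m_def)
    define v w where "v = take (length u - m) u" and "w = drop (length u - m) u"
    have w: "rev (take m (rev u)) = w" by (simp add: w_def take_rev)
    have "length u mod s = m mod s" by (simp add: m_def del: mult_Suc add_mult_distrib)
    then have "s dvd length v" using m by (simp add: v_def mod_eq_dvd_iff_nat)
    then have "stretched u = stretched v @ stretched w"
      using stretched_append[of v w] take_drop_lists[OF u] by (simp add: v_def w_def)
    moreover have "k \<le> length (stretched w)"
      using length_stretched_ge[of w] take_drop_lists[OF u] m k_le(1) by (simp add: w_def m_def)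
    ultimately have *: "take k (rev (stretched u)) = take k (rev (stretched w))" by simp
    have "\<not> length (take ?K (rev u)) < ?K" "take m (take ?K (rev u)) = take m (rev u)"
      using False m(1) by (simp_all only: take_take min_absorb1 length_take length_rev)
    then show ?thesis unfolding m_def[symmetric] by (simp only: if_False w *)
  qed simp
  ultimately show ?thesis
    using length_stretched_mod[OF u] by (simp add: border_def stretched_border_def)
qed

end

context logic_variety
begin

text \<open>Each word is congruent to its stretching, so \<open>L\<close> can be tested on the
  latter. The windows of the stretching are the image under \<open>chunk\<close> of windows modulo
  \<open>s\<close>, its border is a function of the border of \<open>u\<close>, and inverse
  morphisms preserve definability.\<close>

lemma window_definable_unstretch:
  assumes "window_definable F k d A L" and A: "finite A" and s: "0 < s" "s \<le> d"
    and stable: "\<forall>u\<in>words_of_length A s. \<exists>v\<in>words_of_length A d. (u, v) \<in> syntactic_congruence A L"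
  shows "window_definable F ((k + 2) * s) s A L"
proof -
  obtain f where f: "\<And>u. u \<in> words_of_length A s \<Longrightarrow>
      f u \<in> words_of_length A d \<and> (u, f u) \<in> syntactic_congruence A L"
    using stable by metis
  interpret block_map A s d f
    using s f by unfold_locales (auto simp: words_of_length_def)
  let ?K = "(k + 2) * s"
  let ?B = "window_alphabet A k d" and ?B' = "window_alphabet A ?K s"
  obtain K where K: "\<And>t. definable F ?B (K t)"
      "\<And>u. u \<in> nonempty_words A \<Longrightarrow> u \<in> L \<longleftrightarrow> windows k d u \<in> K (border k d u)"
    using assms(1) unfolding window_definable_def by blast
  define K' where "K' t = {v \<in> lists ?B'. concat (map (chunk k) v) \<in> K (stretched_border k t)}" for t
  have "chunk k b \<in> lists ?B" if "b \<in> ?B'" for b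
  proof -
    have "windows k d (stretched (window_word b)) \<in> lists ?B"
      using that d_pos by (intro windows_in_lists stretched_lists) (auto elim: window_alphabetE)
    then show ?thesis by (auto simp: chunk_def lists_eq_set dest: in_set_takeD)
  qed
  then have "definable F ?B' (K' t)" for t
    unfolding K'_def using K(1) A
    by (intro definable_inverse_morphism[where B = ?B]) (auto intro: finite_window_alphabet)
  moreover have "u \<in> L \<longleftrightarrow> windows ?K s u \<in> K' (border ?K s u)" if "u \<in> nonempty_words A" for u
  proof -
    have u: "u \<in> lists A" "u \<noteq> []" using that by (auto simp: nonempty_words_def)
    have "(u, stretched u) \<in> syntactic_congruence A L"
      using u(1)
    proof (induction rule: stretch_induct)
      case (short u)
      then show ?case by (simp add: stretched_short syntactic_congruence_def)
    next
      case (block u)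
      then have "take s u \<in> words_of_length A s"
        using take_drop_lists(1) by (simp add: words_of_length_def)
      then show ?case
        using block syntactic_congruence_append[of "take s u" "f (take s u)" A L "drop s u"] f
        by (simp add: stretched_block)
    qed
    then have "[] @ u @ [] \<in> L \<longleftrightarrow> [] @ stretched u @ [] \<in> L"
      unfolding syntactic_congruence_def by blast
    \<comment> \<open>The hypothesis on \<open>K\<close> concerns nonempty words only; stretching
      never shortens a word.\<close>
    moreover have "stretched u \<in> nonempty_words A"
      using stretched_lists[OF u(1)] length_stretched_ge[OF u(1)] u(2)
      by (auto simp: nonempty_words_def)
    ultimately show ?thesis
      using K(2)[of "stretched u"] windows_in_lists[OF u(1) s(1)]
      by (simp add: K'_def windows_stretched[OF u(1)] border_stretched[OF u(1)] del: add_2_eq_Suc')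
  qed
  ultimately show ?thesis unfolding window_definable_def by blast
qed

end


section \<open>Annotating letters with positions\<close>

primrec lift :: "nat \<Rightarrow> nat \<Rightarrow> word \<Rightarrow> word" where
  "lift d i [] = []"
| "lift d i (a # u) = prod_encode (a, i) # lift d (Suc i mod d) u"

definition lifted_alphabet :: "letter set \<Rightarrow> nat \<Rightarrow> letter set" where
  "lifted_alphabet A d = prod_encode ` (A \<times> {..<d})"

definition base :: "letter \<Rightarrow> letter" where
  "base a = fst (prod_decode a)"

definition residue :: "letter \<Rightarrow> nat" where
  "residue a = snd (prod_decode a)"

lemma base_residue_encode [simp]: "base (prod_encode (a, i)) = a" "residue (prod_encode (a, i)) = i"
  by (simp_all add: base_def residue_def)

lemma length_lift [simp]: "length (lift d i u) = length u"
  by (induction u arbitrary: i) auto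

lemma nth_lift:
  "i < d \<Longrightarrow> x < length u \<Longrightarrow> lift d i u ! x = prod_encode (u ! x, (i + x) mod d)"
  by (induction u arbitrary: i x) (auto simp: nth_Cons mod_simps split: nat.split)

lemma take_lift: "take k (lift d i u) = lift d i (take k u)"
  by (induction u arbitrary: i k) (auto simp: take_Cons split: nat.split)

lemma drop_lift: "i < d \<Longrightarrow> drop x (lift d i u) = lift d ((i + x) mod d) (drop x u)"
  by (induction u arbitrary: i x) (auto simp: drop_Cons mod_simps split: nat.split)

lemma map_base_lift [simp]: "map base (lift d i u) = u"
  by (induction u arbitrary: i) auto

lemma inj_lift: "inj (lift d i)"
  by (metis injI map_base_lift)

lemma lift_in_lists: "u \<in> lists A \<Longrightarrow> i < d \<Longrightarrow> lift d i u \<in> lists (lifted_alphabet A d)"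
  by (induction u arbitrary: i) (auto simp: lifted_alphabet_def)

lemma finite_lifted_alphabet: "finite A \<Longrightarrow> finite (lifted_alphabet A d)"
  by (simp add: lifted_alphabet_def)

lemma map_base_in_lists: "v \<in> lists (lifted_alphabet A d) \<Longrightarrow> map base v \<in> lists A"
  by (induction v) (auto simp: lifted_alphabet_def)

text \<open>Correctness of an annotation is a local condition: the start value is visible in the
  border, and the relation between neighbours in windows of length two.\<close>

lemma lift_iff:
  assumes "v \<noteq> []" "0 < d"
  shows "lift d 0 (map base v) = v \<longleftrightarrow>
    residue (v ! 0) = 0 \<and> (\<forall>x. Suc x < length v \<longrightarrow> residue (v ! Suc x) = Suc (residue (v ! x)) mod d)"
proof
  assume eq: "lift d 0 (map base v) = v"
  have "residue (v ! x) = x mod d" if "x < length v" for x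
    using arg_cong[OF nth_lift[of 0 d x "map base v"], of residue] that assms(2) by (simp add: eq)
  then show "residue (v ! 0) = 0 \<and>
      (\<forall>x. Suc x < length v \<longrightarrow> residue (v ! Suc x) = Suc (residue (v ! x)) mod d)"
    using assms by (auto simp: mod_Suc_eq)
next
  assume *: "residue (v ! 0) = 0 \<and>
      (\<forall>x. Suc x < length v \<longrightarrow> residue (v ! Suc x) = Suc (residue (v ! x)) mod d)"
  have res: "residue (v ! x) = x mod d" if "x < length v" for x
    using that * by (induction x) (auto simp: mod_Suc_eq)
  have "prod_encode (base (v ! x), x mod d) = v ! x" if "x < length v" for x
    unfolding res[OF that, symmetric] by (simp add: base_def residue_def)
  then show "lift d 0 (map base v) = v"
    using assms by (intro nth_equalityI) (auto simp: nth_lift)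
qed

context logic_variety
begin

text \<open>Annotations in a window are determined by the residue where it starts, those in the
  suffix by the length modulo \<open>d\<close>. Windows and border of the annotated word are
  therefore functions of those of \<open>u\<close>.\<close>

lemma window_definable_of_lift:
  assumes "window_definable F k 1 (lifted_alphabet A d) (lift d 0 ` L)" "finite A" "0 < d"
  shows "window_definable F k d A L"
proof -
  let ?B = "window_alphabet (lifted_alphabet A d) k 1" and ?B' = "window_alphabet A k d"
  obtain K where K: "\<And>t. definable F ?B (K t)"
      "\<And>v. v \<in> nonempty_words (lifted_alphabet A d) \<Longrightarrow>
        v \<in> lift d 0 ` L \<longleftrightarrow> windows k 1 v \<in> K (border k 1 v)"
    using assms(1) unfolding window_definable_def by blast
  define g where "g b = window_letter (lift d (window_index b) (window_word b)) 0" for b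
  \<comment> \<open>Entry \<open>j\<close> of the reversed suffix comes from the position
    \<open>j + 1\<close> before the end. Its residue is written without subtraction, as
    \<open>d - 1\<close> is congruent to -1 modulo \<open>d\<close>. The final 0 is the length
    modulo 1.\<close>
  define G where "G t = (case t of (p, q, r) \<Rightarrow>
    (lift d 0 p, map (\<lambda>j. prod_encode (q ! j, (r + (d - 1) * (j + 1)) mod d)) [0..<length q], 0 :: nat))" for t
  define K' where "K' t = {v \<in> lists ?B'. map g v \<in> K (G t)}" for t
  have "g b \<in> ?B" if b: "b \<in> ?B'" for b
  proof -
    obtain w i where "b = window_letter w i" "w \<in> lists A" "length w \<le> k" "i < d"
      by (rule window_alphabetE[OF b])
    then show ?thesis
      using lift_in_lists[of w A i d] by (auto simp: g_def window_alphabet_def)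
  qed
  then have "definable F ?B' (K' t)" for t
    unfolding K'_def using K(1) assms(2)
    by (intro definable_letter_map[where B = ?B])
      (auto intro: finite_window_alphabet finite_lifted_alphabet)
  moreover have "u \<in> L \<longleftrightarrow> windows k d u \<in> K' (border k d u)" if "u \<in> nonempty_words A" for u
  proof -
    let ?v = "lift d 0 u"
    have u: "u \<in> lists A" "u \<noteq> []" using that by (auto simp: nonempty_words_def)
    have "map g (windows k d u) = windows k 1 ?v"
      using assms(3) by (intro nth_equalityI) (auto simp: g_def drop_lift take_lift)
    moreover have "G (border k d u) = border k 1 ?v"
    proof -
      have "map (\<lambda>j. prod_encode (take k (rev u) ! j, (length u mod d + (d - 1) * (j + 1)) mod d))
          [0..<length (take k (rev u))] = take k (rev ?v)"
      proof (rule nth_equalityI)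
        fix j assume "j < length (map (\<lambda>j. prod_encode (take k (rev u) ! j,
          (length u mod d + (d - 1) * (j + 1)) mod d)) [0..<length (take k (rev u))])"
        then have j: "j < k" "j < length u" by auto
        have "length u + (d - 1) * (j + 1) = (length u - Suc j) + d * (j + 1)"
          using j assms(3) by (cases d) auto
        then have "(length u mod d + (d - 1) * (j + 1)) mod d = (length u - Suc j) mod d"
          by (metis mod_add_left_eq mod_mult_self2)
        then show "map (\<lambda>j. prod_encode (take k (rev u) ! j,
            (length u mod d + (d - 1) * (j + 1)) mod d)) [0..<length (take k (rev u))] ! j =
            take k (rev ?v) ! j"
          using j assms(3) by (simp add: rev_nth nth_lift)
      qed simp
      then show ?thesis by (simp add: G_def border_def take_lift)
    qed
    moreover have "?v \<in> nonempty_words (lifted_alphabet A d)"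
      using u lift_in_lists[OF u(1) assms(3)] by (cases u) (auto simp: nonempty_words_def)
    moreover have "?v \<in> lift d 0 ` L \<longleftrightarrow> u \<in> L"
      using inj_lift[of d 0] by (simp add: inj_image_mem_iff)
    ultimately show ?thesis
      using K(2)[of ?v] windows_in_lists[OF u(1) assms(3)] by (simp add: K'_def)
  qed
  ultimately show ?thesis unfolding window_definable_def by blast
qed

text \<open>The residue of a position is the annotation of the first letter of its window, and the
  length modulo \<open>d\<close> follows from the last annotation. Inconsistent annotations must be
  rejected as well; the length \<open>k + 2\<close> leaves room for two neighbours in a window and
  makes prefix and suffix of a nonempty word nonempty.\<close>

lemma window_definable_lift:
  assumes "window_definable F k d A L" "finite A" "0 < d" "L \<subseteq> nonempty_words A"
  shows "window_definable F (k + 2) 1 (lifted_alphabet A d) (lift d 0 ` L)"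
proof -
  let ?A = "lifted_alphabet A d"
  let ?B = "window_alphabet A k d" and ?B' = "window_alphabet ?A (k + 2) 1"
  obtain K where K: "\<And>t. definable F ?B (K t)"
      "\<And>u. u \<in> nonempty_words A \<Longrightarrow> u \<in> L \<longleftrightarrow> windows k d u \<in> K (border k d u)"
    using assms(1) unfolding window_definable_def by blast
  \<comment> \<open>Only the window at the last position has fewer than two letters, and it has no
    successor to compare with.\<close>
  define good where "good b \<longleftrightarrow> (2 \<le> length (window_word b) \<longrightarrow>
    residue (window_word b ! 1) = Suc (residue (window_word b ! 0)) mod d)" for b
  \<comment> \<open>The outer \<open>mod d\<close> keeps the value in the window alphabet even for
    the code of the empty word, a letter of the source alphabet that never arises as a
    window.\<close>
  define g where
    "g b = window_letter (take k (map base (window_word b))) (residue (window_word b ! 0) mod d)" for b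
  define G where "G t = (case t of (p, q, r :: nat) \<Rightarrow>
    (take k (map base p), take k (map base q), Suc (residue (q ! 0)) mod d))" for t
  \<comment> \<open>The start value is decided by the border; the condition on neighbours is a
    condition on all letters, definable because \<open>V\<close> contains a monoid that is not a
    group.\<close>
  define K' where "K' t = (if residue (fst t ! 0) = 0
     then {y \<in> lists ?B'. \<forall>b\<in>set y. good b} \<inter> {y \<in> lists ?B'. map g y \<in> K (G t)} else {})" for t
  have fin: "finite ?B" "finite ?B'"
    using assms(2) by (auto intro: finite_window_alphabet finite_lifted_alphabet)
  have "g b \<in> ?B" if b_in: "b \<in> ?B'" for b
  proof -
    obtain w i where b: "b = window_letter w i" "w \<in> lists ?A" by (rule window_alphabetE[OF b_in])
    then have "take k (map base w) \<in> lists A"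
      using map_base_in_lists[OF b(2)] by (auto simp: lists_eq_set dest!: in_set_takeD)
    then show ?thesis using b assms(3) by (force simp: g_def window_alphabet_def)
  qed
  then have "definable F ?B' (K' t)" for t
    using definable_Int[OF definable_all_letters[OF fin(2), of good]
        definable_letter_map[OF K(1)[of "G t"] fin]] definable_empty
    by (simp add: K'_def)
  moreover have "v \<in> lift d 0 ` L \<longleftrightarrow> windows (k + 2) 1 v \<in> K' (border (k + 2) 1 v)"
    if "v \<in> nonempty_words ?A" for v
  proof -
    let ?y = "windows (k + 2) 1 v" and ?t = "border (k + 2) 1 v" and ?u = "map base v"
    have v: "v \<in> lists ?A" "v \<noteq> []" using that by (auto simp: nonempty_words_def)
    have y: "?y \<in> lists ?B'" using windows_in_lists[OF v(1)] by simp
    have u: "?u \<in> nonempty_words A"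
      using map_base_in_lists[OF v(1)] v(2) by (simp add: nonempty_words_def)
    have "good (?y ! x) \<longleftrightarrow> (Suc x < length v \<longrightarrow> residue (v ! Suc x) = Suc (residue (v ! x)) mod d)"
      if "x < length v" for x
      using that by (auto simp: good_def)
    then have "(\<forall>b\<in>set ?y. good b) \<longleftrightarrow>
        (\<forall>x. Suc x < length v \<longrightarrow> residue (v ! Suc x) = Suc (residue (v ! x)) mod d)"
      by (auto simp: all_set_conv_all_nth)
    then have lift: "residue (fst ?t ! 0) = 0 \<and> (\<forall>b\<in>set ?y. good b) \<longleftrightarrow> lift d 0 ?u = v"
      using lift_iff[OF v(2) assms(3)] by (simp add: border_def)
    have "map g ?y = windows k d ?u \<and> G ?t = border k d ?u" if eq: "lift d 0 ?u = v"
    proof -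
      have res: "residue (v ! x) = x mod d" if "x < length v" for x
        using arg_cong[OF nth_lift[of 0 d x ?u], of residue] that assms(3) by (simp add: eq)
      have "take k (map base (take (k + 2) w)) = take k (map base w)" for w
        by (simp add: take_map)
      then have "map g ?y = windows k d ?u"
        by (intro nth_equalityI) (auto simp: g_def res drop_map take_map)
      moreover have "take (k + 2) (rev v) ! 0 = v ! (length v - 1)"
        using v(2) by (simp add: rev_nth)
      then have "G ?t = border k d ?u"
        using v(2) by (simp add: G_def border_def res take_map rev_map mod_Suc_eq)
      ultimately show ?thesis by blast
    qed
    then have "?y \<in> K' ?t \<longleftrightarrow> lift d 0 ?u = v \<and> windows k d ?u \<in> K (border k d ?u)"
      using lift y by (auto simp: K'_def)
    also have "\<dots> \<longleftrightarrow> lift d 0 ?u = v \<and> ?u \<in> L"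
      using K(2)[OF u] by simp
    also have "\<dots> \<longleftrightarrow> v \<in> lift d 0 ` L"
      by (metis image_iff map_base_lift)
    finally show ?thesis by simp
  qed
  ultimately show ?thesis unfolding window_definable_def by blast
qed

end


section \<open>Recursive functions\<close>

text \<open>\<open>recursive n\<close> is not extensional on lists of length \<open>n\<close>, which this closure repairs.\<close>

definition computable :: "nat \<Rightarrow> (nat list \<Rightarrow> nat) \<Rightarrow> bool" where
  "computable n f \<longleftrightarrow> (\<exists>f'. recursive n f' \<and> (\<forall>xs. length xs = n \<longrightarrow> f' xs = f xs))"

named_theorems computable_intros

lemma computable_cong:
  "computable n f \<Longrightarrow> (\<And>xs. length xs = n \<Longrightarrow> f xs = g xs) \<Longrightarrow> computable n g"
  by (auto simp: computable_def)

lemma computable_comp: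
  assumes "computable (length gs) f" "\<forall>g\<in>set gs. computable n g"
  shows "computable n (\<lambda>xs. f (map (\<lambda>g. g xs) gs))"
proof -
  obtain f' where f': "recursive (length gs) f'" "\<And>xs. length xs = length gs \<Longrightarrow> f' xs = f xs"
    using assms(1) by (auto simp: computable_def)
  have "\<forall>g\<in>set gs. \<exists>g'. recursive n g' \<and> (\<forall>xs. length xs = n \<longrightarrow> g' xs = g xs)"
    using assms(2) by (simp add: computable_def)
  then obtain G where G: "\<forall>g\<in>set gs. recursive n (G g) \<and> (\<forall>xs. length xs = n \<longrightarrow> G g xs = g xs)"
    by metis
  have "recursive n (\<lambda>xs. f' (map (\<lambda>g. g xs) (map G gs)))"
    using f'(1) G by (intro recursive.comp) auto
  moreover have "f' (map (\<lambda>g. g xs) (map G gs)) = f (map (\<lambda>g. g xs) gs)" if "length xs = n" for xs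
  proof -
    have eq: "map (\<lambda>g. g xs) (map G gs) = map (\<lambda>g. g xs) gs" using G that by auto
    show ?thesis unfolding eq by (rule f'(2)) simp
  qed
  ultimately show ?thesis unfolding computable_def by blast
qed

lemma computable_proj [computable_intros]: "i < n \<Longrightarrow> computable n (\<lambda>xs. xs ! i)"
  unfolding computable_def using recursive.proj by blast

lemma computable_comp1:
  assumes "computable 1 (\<lambda>xs. \<phi> (xs ! 0))" "computable n f"
  shows "computable n (\<lambda>xs. \<phi> (f xs))"
  using computable_comp[of "[f]" "\<lambda>xs. \<phi> (xs ! 0)" n] assms by simp

lemma computable_comp2:
  assumes "computable 2 (\<lambda>xs. \<phi> (xs ! 0) (xs ! 1))" "computable n f" "computable n g"
  shows "computable n (\<lambda>xs. \<phi> (f xs) (g xs))"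
  using computable_comp[of "[f, g]" "\<lambda>xs. \<phi> (xs ! 0) (xs ! 1)" n] assms by (simp add: numeral_2_eq_2)

lemma computable_comp3:
  assumes "computable 3 (\<lambda>xs. \<phi> (xs ! 0) (xs ! 1) (xs ! 2))"
    "computable n f" "computable n g" "computable n h"
  shows "computable n (\<lambda>xs. \<phi> (f xs) (g xs) (h xs))"
  using computable_comp[of "[f, g, h]" "\<lambda>xs. \<phi> (xs ! 0) (xs ! 1) (xs ! 2)" n] assms
  by (simp add: numeral_3_eq_3 numeral_2_eq_2)

lemma computable_Suc [computable_intros]: "computable n f \<Longrightarrow> computable n (\<lambda>xs. Suc (f xs))"
  by (rule computable_comp1[of Suc]) (use recursive.succ in \<open>auto simp: computable_def\<close>)

lemma computable_const [computable_intros]: "computable n (\<lambda>xs. c)"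
proof (induction c)
  case 0
  then show ?case using recursive.zero by (auto simp: computable_def)
qed (rule computable_Suc)

lemma computable_prim_rec:
  assumes f: "computable n f" and g: "computable (n + 2) g"
  shows "computable (n + 1) (\<lambda>xs. rec_nat (f (tl xs)) (\<lambda>y r. g (y # r # tl xs)) (hd xs))"
proof -
  obtain f' where f': "recursive n f'" "\<And>xs. length xs = n \<Longrightarrow> f' xs = f xs"
    using f by (auto simp: computable_def)
  obtain g' where g': "recursive (n + 2) g'" "\<And>xs. length xs = n + 2 \<Longrightarrow> g' xs = g xs"
    using g by (auto simp: computable_def)
  have "rec_nat (f' ys) (\<lambda>y r. g' (y # r # ys)) m = rec_nat (f ys) (\<lambda>y r. g (y # r # ys)) m"
    if "length ys = n" for ys m
    using that by (induction m) (auto simp: f'(2) g'(2))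
  then show ?thesis
    unfolding computable_def using recursive.prim_rec[OF f'(1) g'(1)] by fastforce
qed

lemma computable_rec:
  assumes f: "computable 1 (\<lambda>xs. f (xs ! 0))"
    and g: "computable 3 (\<lambda>xs. g (xs ! 0) (xs ! 1) (xs ! 2))"
    and "computable n c" "computable n a"
  shows "computable n (\<lambda>xs. rec_nat (f (a xs)) (\<lambda>y r. g y r (a xs)) (c xs))"
proof (rule computable_comp2[OF _ assms(3,4), of "\<lambda>c a. rec_nat (f a) (\<lambda>y r. g y r a) c"])
  have "(1 :: nat) + 2 = 3" by simp
  then have "computable (1 + 2) (\<lambda>xs. g (xs ! 0) (xs ! 1) (xs ! 2))"
    using g by (simp only:)
  then have "computable (1 + 1) (\<lambda>xs. rec_nat (f (tl xs ! 0))
      (\<lambda>y r. (\<lambda>xs. g (xs ! 0) (xs ! 1) (xs ! 2)) (y # r # tl xs)) (hd xs))"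
    using f by (intro computable_prim_rec)
  then show "computable 2 (\<lambda>xs. rec_nat (f (xs ! 1)) (\<lambda>y r. g y r (xs ! 1)) (xs ! 0))"
    unfolding one_add_one
    by (rule computable_cong) (auto simp: length_Suc_conv numeral_2_eq_2)
qed

lemma computable_rec0:
  assumes "computable 2 (\<lambda>xs. g (xs ! 0) (xs ! 1))" "computable n c"
  shows "computable n (\<lambda>xs. rec_nat k g (c xs))"
proof -
  have "computable 3 (\<lambda>xs. g (xs ! 0) (xs ! 1))"
    by (intro computable_comp2[OF assms(1)] computable_proj) auto
  then show ?thesis
    using computable_rec[where f = "\<lambda>_. k" and g = "\<lambda>y r a. g y r" and c = c and a = "\<lambda>_. 0",
        OF computable_const _ assms(2) computable_const] by blast
qed

lemma computable_add [computable_intros]: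
  assumes "computable n f" "computable n g"
  shows "computable n (\<lambda>xs. f xs + g xs)"
proof -
  have *: "rec_nat a (\<lambda>y r. Suc r) c = a + c" for a c :: nat by (induction c) auto
  have "computable 3 (\<lambda>xs. Suc (xs ! 1))" by (intro computable_intros) simp
  from computable_rec[where f = "\<lambda>a. a" and g = "\<lambda>y r a. Suc r",
      OF computable_proj[OF zero_less_one] this assms(1,2)]
  show ?thesis by (simp only: * add.commute)
qed

lemma computable_mult [computable_intros]:
  assumes "computable n f" "computable n g"
  shows "computable n (\<lambda>xs. f xs * g xs)"
proof -
  have *: "rec_nat 0 (\<lambda>y r. r + a) c = c * a" for a c :: nat by (induction c) auto
  have "computable 3 (\<lambda>xs. xs ! 1 + xs ! 2)" by (intro computable_intros) auto
  from computable_rec[where f = "\<lambda>a. 0" and g = "\<lambda>y r a. r + a", OF computable_const this assms]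
  show ?thesis by (simp only: *)
qed

lemma computable_pred [computable_intros]:
  assumes "computable n f"
  shows "computable n (\<lambda>xs. f xs - 1)"
proof -
  have *: "rec_nat 0 (\<lambda>y r. y) c = c - 1" for c :: nat by (induction c) auto
  have "computable 2 (\<lambda>xs. xs ! 0)" by (intro computable_intros) simp
  from computable_rec0[where k = 0 and g = "\<lambda>y r. y", OF this assms]
  show ?thesis by (simp only: *)
qed

lemma computable_diff [computable_intros]:
  assumes "computable n f" "computable n g"
  shows "computable n (\<lambda>xs. f xs - g xs)"
proof -
  have *: "rec_nat a (\<lambda>y r. r - 1) c = a - c" for a c :: nat by (induction c) auto
  have "computable 3 (\<lambda>xs. xs ! 1 - 1)" by (intro computable_intros) simp
  from computable_rec[where f = "\<lambda>a. a" and g = "\<lambda>y r a. r - 1",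
      OF computable_proj[OF zero_less_one] this assms(2,1)]
  show ?thesis by (simp only: *)
qed

lemma computable_power2 [computable_intros]:
  assumes "computable n f"
  shows "computable n (\<lambda>xs. 2 ^ f xs)"
proof -
  have *: "rec_nat 1 (\<lambda>y r. r + r) c = (2 :: nat) ^ c" for c by (induction c) auto
  have "computable 2 (\<lambda>xs. xs ! 1 + xs ! 1)" by (intro computable_intros) auto
  from computable_rec0[where k = 1 and g = "\<lambda>y r. r + r", OF this assms]
  show ?thesis by (simp only: *)
qed

lemma computable_fact [computable_intros]:
  assumes "computable n f"
  shows "computable n (\<lambda>xs. fact (f xs))"
proof -
  have *: "rec_nat 1 (\<lambda>y r. Suc y * r) c = fact c" for c :: nat by (induction c) auto
  have "computable 2 (\<lambda>xs. Suc (xs ! 0) * xs ! 1)" by (intro computable_intros) auto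
  from computable_rec0[where k = 1 and g = "\<lambda>y r. Suc y * r", OF this assms]
  show ?thesis by (simp only: *)
qed

lemma computable_triangle [computable_intros]:
  assumes "computable n f"
  shows "computable n (\<lambda>xs. triangle (f xs))"
proof -
  have *: "rec_nat 0 (\<lambda>y r. r + Suc y) c = triangle c" for c :: nat by (induction c) auto
  have "computable 2 (\<lambda>xs. xs ! 1 + Suc (xs ! 0))" by (intro computable_intros) auto
  from computable_rec0[where k = 0 and g = "\<lambda>y r. r + Suc y", OF this assms]
  show ?thesis by (simp only: *)
qed

lemma computable_prod_encode [computable_intros]:
  assumes "computable n f" "computable n g"
  shows "computable n (\<lambda>xs. prod_encode (f xs, g xs))"
  unfolding prod_encode_def prod.case using assms by (intro computable_intros)

lemma computable_if_zero [computable_intros]: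
  assumes "computable n f" "computable n g" "computable n h"
  shows "computable n (\<lambda>xs. if f xs = 0 then g xs else h xs)"
proof -
  \<comment> \<open>With truncated subtraction, \<open>1 - f xs\<close> is the truth value of
    \<open>f xs = 0\<close>.\<close>
  have "computable n (\<lambda>xs. (1 - f xs) * g xs + (1 - (1 - f xs)) * h xs)"
    using assms by (intro computable_intros)
  then show ?thesis by (rule computable_cong) auto
qed

lemma computable_minim:
  assumes f: "computable (n + 1) f" and ex: "\<forall>xs. length xs = n \<longrightarrow> (\<exists>y. f (y # xs) = 0)"
  shows "computable n (\<lambda>xs. LEAST y. f (y # xs) = 0)"
proof -
  obtain f' where f': "recursive (n + 1) f'" "\<And>xs. length xs = n + 1 \<Longrightarrow> f' xs = f xs"
    using f by (auto simp: computable_def)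
  have "recursive n (\<lambda>xs. LEAST y. f' (y # xs) = 0)"
    using f'(1) by (rule recursive.minim) (use ex f'(2) in auto)
  then show ?thesis
    unfolding computable_def using f'(2) by fastforce
qed

section \<open>Decoding pairs and lists\<close>

lemma triangle_mono: "m \<le> n \<Longrightarrow> triangle m \<le> triangle n"
  by (induction n arbitrary: m) (auto simp: le_Suc_eq intro: trans_le_add1)

lemma le_triangle: "n \<le> triangle n"
  by (induction n) auto

text \<open>\<open>prod_encode (a, b)\<close> is \<open>triangle (a + b) + a\<close>. The search for
  the first \<open>t\<close> with \<open>z < triangle (Suc t)\<close> finds \<open>a + b\<close>,
  from which both components follow.\<close>

definition diagonal :: "nat \<Rightarrow> nat" where
  "diagonal z = (LEAST t. Suc z - triangle (Suc t) = 0)"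

lemma diagonal_prod_encode: "diagonal (prod_encode (a, b)) = a + b"
  unfolding diagonal_def
proof (rule Least_equality)
  show "Suc (prod_encode (a, b)) - triangle (Suc (a + b)) = 0"
    by (simp add: prod_encode_def)
next
  fix t assume t: "Suc (prod_encode (a, b)) - triangle (Suc t) = 0"
  show "a + b \<le> t"
  proof (rule ccontr)
    assume "\<not> a + b \<le> t"
    then have "triangle (Suc t) \<le> triangle (a + b)" by (intro triangle_mono) simp
    then show False using t by (simp add: prod_encode_def)
  qed
qed

lemma computable_diagonal [computable_intros]:
  assumes "computable n f"
  shows "computable n (\<lambda>xs. diagonal (f xs))"
proof (rule computable_comp1[OF _ assms])
  have "computable (1 + 1) (\<lambda>xs. Suc (xs ! 1) - triangle (Suc (xs ! 0)))"
    by (intro computable_intros) auto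
  moreover have "\<exists>y. Suc z - triangle (Suc y) = 0" for z
    using le_triangle[of "Suc z"] by (intro exI[of _ z]) simp
  ultimately show "computable 1 (\<lambda>xs. diagonal (xs ! 0))"
    unfolding diagonal_def
    using computable_minim[of 1 "\<lambda>xs. Suc (xs ! 1) - triangle (Suc (xs ! 0))"] by simp
qed

lemma computable_fst_decode [computable_intros]:
  assumes "computable n f"
  shows "computable n (\<lambda>xs. fst (prod_decode (f xs)))"
proof -
  have *: "z - triangle (diagonal z) = fst (prod_decode z)" for z
  proof -
    obtain a b where "prod_decode z = (a, b)" by fastforce
    moreover from this have "z = prod_encode (a, b)" by (metis prod_decode_inverse)
    ultimately show ?thesis by (simp add: diagonal_prod_encode) (simp add: prod_encode_def)
  qed
  have "computable n (\<lambda>xs. f xs - triangle (diagonal (f xs)))"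
    using assms by (intro computable_intros)
  then show ?thesis by (simp only: *)
qed

lemma computable_snd_decode [computable_intros]:
  assumes "computable n f"
  shows "computable n (\<lambda>xs. snd (prod_decode (f xs)))"
proof -
  have *: "diagonal z - fst (prod_decode z) = snd (prod_decode z)" for z
    using diagonal_prod_encode[of "fst (prod_decode z)" "snd (prod_decode z)"] by simp
  have "computable n (\<lambda>xs. diagonal (f xs) - fst (prod_decode (f xs)))"
    using assms by (intro computable_intros)
  then show ?thesis by (simp only: *)
qed

text \<open>A nonempty list is coded as the successor of the pair of its head and the code of its
  tail.\<close>

definition code_hd :: "nat \<Rightarrow> nat" where
  "code_hd c = fst (prod_decode (c - 1))"

definition code_drop :: "nat \<Rightarrow> nat \<Rightarrow> nat" where
  "code_drop n c = rec_nat c (\<lambda>y r. snd (prod_decode (r - 1))) n"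

lemma code_drop_list_encode [simp]: "code_drop n (list_encode xs) = list_encode (drop n xs)"
proof (induction n)
  case (Suc n)
  have "snd (prod_decode (list_encode ys - 1)) = list_encode (tl ys)" for ys
  proof (cases ys)
    case Nil
    \<comment> \<open>The empty list has code 0, and 0 - 1 = 0 decodes to a pair of zeros, so the
      tail of the empty list is again empty.\<close>
    then show ?thesis using prod_encode_inverse[of "(0, 0)"] by (simp add: prod_encode_def)
  qed simp
  then show ?case using Suc by (simp add: code_drop_def drop_Suc tl_drop)
qed (simp add: code_drop_def)

lemma code_hd_list_encode [simp]: "xs \<noteq> [] \<Longrightarrow> code_hd (list_encode xs) = hd xs"
  by (cases xs) (auto simp: code_hd_def)

lemma computable_code_hd [computable_intros]:
  "computable n f \<Longrightarrow> computable n (\<lambda>xs. code_hd (f xs))"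
  unfolding code_hd_def by (intro computable_intros)

lemma computable_code_drop [computable_intros]:
  assumes "computable n f" "computable n g"
  shows "computable n (\<lambda>xs. code_drop (f xs) (g xs))"
proof -
  have "computable 3 (\<lambda>xs. snd (prod_decode (xs ! 1 - 1)))" by (intro computable_intros) simp
  from computable_rec[where f = "\<lambda>a. a" and g = "\<lambda>y r a. snd (prod_decode (r - 1))",
      OF computable_proj[OF zero_less_one] this assms]
  show ?thesis by (simp only: code_drop_def)
qed

section \<open>Computing lists by bounded search\<close>

text \<open>Primitive recursion on the bound accumulates the code of the list. Only its set of
  elements is specified, since the language of an automaton depends only on the sets of its
  lists.\<close>

lemma computable_collect:
  assumes "computable 1 (\<lambda>xs. b (xs ! 0))" "computable 2 (\<lambda>xs. val (xs ! 0) (xs ! 1))"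
    "computable 2 (\<lambda>xs. cond (xs ! 0) (xs ! 1))"
  shows "\<exists>ys. computable 1 (\<lambda>xs. list_encode (ys (xs ! 0))) \<and>
    (\<forall>x. set (ys x) = {val y x | y. y < b x \<and> cond y x = 0})"
proof -
  define zs where
    "zs x m = rec_nat [] (\<lambda>y r. if cond y x = 0 then val y x # r else r) m" for x m
  have "set (zs x m) = {val y x | y. y < m \<and> cond y x = 0}" for x m
    by (induction m) (auto simp: zs_def less_Suc_eq)
  moreover have "computable 1 (\<lambda>xs. list_encode (zs (xs ! 0) (b (xs ! 0))))"
  proof -
    have *: "list_encode (zs x m) =
        rec_nat 0 (\<lambda>y r. if cond y x = 0 then Suc (prod_encode (val y x, r)) else r) m" for x m
      by (induction m) (auto simp: zs_def)
    have "computable 3 (\<lambda>xs. if cond (xs ! 0) (xs ! 2) = 0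
        then Suc (prod_encode (val (xs ! 0) (xs ! 2), xs ! 1)) else xs ! 1)"
      by (intro computable_intros computable_comp2[OF assms(2)] computable_comp2[OF assms(3)]) auto
    from computable_rec[where f = "\<lambda>a. 0"
        and g = "\<lambda>y r x. if cond y x = 0 then Suc (prod_encode (val y x, r)) else r",
        OF computable_const this assms(1) computable_proj[OF zero_less_one]]
    show ?thesis by (simp only: *)
  qed
  ultimately show ?thesis by (intro exI[of _ "\<lambda>x. zs x (b x)"]) simp
qed

lemma prod_encode_mono: "a \<le> a' \<Longrightarrow> b \<le> b' \<Longrightarrow> prod_encode (a, b) \<le> prod_encode (a', b')"
  unfolding prod_encode_def prod.case by (intro add_mono triangle_mono)

lemma length_le_list_encode: "length xs \<le> list_encode xs"
  by (induction xs) (auto intro: order_trans[OF _ le_prod_encode_2])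

lemma set_le_list_encode: "x \<in> set xs \<Longrightarrow> x < list_encode xs"
  by (induction xs) (auto simp: less_Suc_eq_le le_prod_encode_1 intro: order_trans[OF less_imp_le le_prod_encode_2])

lemma computable_product:
  assumes c: "computable 1 (\<lambda>xs. c (xs ! 0))" and d: "computable 1 (\<lambda>xs. d (xs ! 0))"
    and val: "computable 3 (\<lambda>xs. val (xs ! 0) (xs ! 1) (xs ! 2))"
  shows "\<exists>ys. computable 1 (\<lambda>xs. list_encode (ys (xs ! 0))) \<and>
    (\<forall>x es. c x = list_encode es \<longrightarrow> set (ys x) = {val e i x | e i. e \<in> set es \<and> i < d x})"
proof -
  \<comment> \<open>A search index codes a list position and a second number. The code of a list
    bounds its length, so the bound \<open>?b\<close> covers every relevant pair.\<close>
  define j i where "j y = fst (prod_decode y)" and "i y = snd (prod_decode y)" for y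
  let ?b = "\<lambda>x. Suc (prod_encode (c x, d x))"
  let ?val = "\<lambda>y x. val (code_hd (code_drop (j y) (c x))) (i y) x"
  \<comment> \<open>A nonempty list has a positive code, so both summands vanish exactly when
    position \<open>j y\<close> exists in the list and \<open>i y < d x\<close>.\<close>
  let ?cond = "\<lambda>y x. (1 - code_drop (j y) (c x)) + (1 - (d x - i y))"
  have b: "computable 1 (\<lambda>xs. ?b (xs ! 0))"
    by (intro computable_intros c d)
  have val': "computable 2 (\<lambda>xs. ?val (xs ! 0) (xs ! 1))"
    unfolding j_def i_def
    by (intro computable_comp3[OF val] computable_intros computable_comp1[OF c]) auto
  have cond: "computable 2 (\<lambda>xs. ?cond (xs ! 0) (xs ! 1))"
    unfolding j_def i_def
    by (intro computable_intros computable_comp1[OF c] computable_comp1[OF d]) auto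
  obtain ys where ys: "computable 1 (\<lambda>xs. list_encode (ys (xs ! 0)))"
      "\<And>x. set (ys x) = {?val y x | y. y < ?b x \<and> ?cond y x = 0}"
    using computable_collect[OF b val' cond] by blast
  have "set (ys x) = {val e i x | e i. e \<in> set es \<and> i < d x}" if x: "c x = list_encode es" for x es
  proof -
    have drop_pos: "0 < list_encode (drop m es) \<longleftrightarrow> m < length es" for m
    proof -
      have "0 < list_encode ys \<longleftrightarrow> ys \<noteq> []" for ys by (cases ys) auto
      then show ?thesis by (simp add: not_le)
    qed
    have cond_iff: "?cond y x = 0 \<longleftrightarrow> j y < length es \<and> i y < d x" for y
      using drop_pos[of "j y"] by (auto simp: x)
    have val_eq: "?val y x = val (es ! j y) (i y) x" if "j y < length es" for y
      using that by (simp add: x hd_drop_conv_nth)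
    show ?thesis
    proof (intro equalityI subsetI)
      fix z assume "z \<in> set (ys x)"
      then obtain y where "z = ?val y x" "?cond y x = 0" unfolding ys(2) mem_Collect_eq by metis
      then have "z = val (es ! j y) (i y) x" "es ! j y \<in> set es" "i y < d x"
        using cond_iff[of y] val_eq[of y] nth_mem[of "j y" es] by auto
      then show "z \<in> {val e i x | e i. e \<in> set es \<and> i < d x}" by blast
    next
      fix z assume "z \<in> {val e i x | e i. e \<in> set es \<and> i < d x}"
      then obtain m k where mk: "m < length es" "k < d x" "z = val (es ! m) k x"
        by (auto simp: in_set_conv_nth)
      define y where "y = prod_encode (m, k)"
      have ji: "j y = m" "i y = k" by (simp_all add: y_def j_def i_def)
      have "y < ?b x"
        unfolding y_def less_Suc_eq_le using mk length_le_list_encode[of es]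
        by (intro prod_encode_mono) (auto simp: x)
      moreover have "?cond y x = 0" "z = ?val y x"
        using cond_iff[of y] val_eq[of y] mk by (simp_all only: ji)
      ultimately show "z \<in> set (ys x)" unfolding ys(2) mem_Collect_eq by metis
    qed
  qed
  then show ?thesis using ys(1) by blast
qed


section \<open>Stable lengths\<close>

primrec reach :: "nfa \<Rightarrow> nat \<Rightarrow> word \<Rightarrow> nat \<Rightarrow> bool" where
  "reach N p [] q \<longleftrightarrow> p = q"
| "reach N p (a # w) q \<longleftrightarrow> (\<exists>p'. (p, a, p') \<in> set (transitions N) \<and> reach N p' w q)"

lemma reach_append: "reach N p (u @ v) r \<longleftrightarrow> (\<exists>q. reach N p u q \<and> reach N q v r)"
  by (induction u arbitrary: p) auto

lemma accepts_from_reach: "accepts_from N p w \<longleftrightarrow> (\<exists>q\<in>set (final N). reach N p w q)"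
  by (induction w arbitrary: p) auto

definition states_below :: "nfa \<Rightarrow> nat \<Rightarrow> bool" where
  "states_below N n \<longleftrightarrow> (\<forall>(p, a, q)\<in>set (transitions N). q < n) \<and> (\<forall>p\<in>set (initial N). p < n)"

lemma reach_below: "states_below N n \<Longrightarrow> p < n \<Longrightarrow> reach N p w q \<Longrightarrow> q < n"
  by (induction w arbitrary: p) (auto simp: states_below_def)

text \<open>The transition relation of \<open>w\<close>, cut off at \<open>n\<close> so that only
  finitely many relations arise.\<close>

definition profile :: "nfa \<Rightarrow> nat \<Rightarrow> word \<Rightarrow> (nat \<times> nat) set" where
  "profile N n w = {(p, q). p < n \<and> q < n \<and> reach N p w q}"

lemma profile_append:
  assumes "states_below N n"
  shows "profile N n (u @ v) = profile N n u O profile N n v"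
  using reach_below[OF assms] by (fastforce simp: profile_def reach_append)

text \<open>A run through a context sees the middle word only by its profile. As both words are
  nonempty, removing the empty word from the language cannot separate them.\<close>

lemma syntactic_congruence_of_profile:
  assumes N: "states_below N n" and uv: "u \<in> lists A" "v \<in> lists A" "u \<noteq> []" "v \<noteq> []"
    and eq: "profile N n u = profile N n v" and A: "A = set (alphabet N)"
  shows "(u, v) \<in> syntactic_congruence A (nfa_language N - {[]})"
proof -
  have accepts: "accepts_from N p (x @ u @ y) \<longleftrightarrow> accepts_from N p (x @ v @ y)"
    if "p \<in> set (initial N)" for p x y
  proof -
    have "p < n" using that N by (auto simp: states_below_def)
    moreover have "profile N n (x @ u @ y) = profile N n (x @ v @ y)"
      by (simp add: profile_append[OF N] eq)
    ultimately have "reach N p (x @ u @ y) q \<longleftrightarrow> reach N p (x @ v @ y) q" for q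
      using reach_below[OF N] unfolding profile_def by blast
    then show ?thesis by (simp add: accepts_from_reach)
  qed
  have "x @ u @ y \<in> nfa_language N - {[]} \<longleftrightarrow> x @ v @ y \<in> nfa_language N - {[]}"
    if "x \<in> lists A" "y \<in> lists A" for x y
    using that uv accepts by (auto simp: nfa_language_def A)
  then show ?thesis using uv by (simp add: syntactic_congruence_def)
qed

definition profiles :: "nfa \<Rightarrow> nat \<Rightarrow> nat \<Rightarrow> (nat \<times> nat) set set" where
  "profiles N n m = profile N n ` words_of_length (set (alphabet N)) m"

lemma words_of_length_add:
  "words_of_length A (m + m') = (\<lambda>(u, v). u @ v) ` (words_of_length A m \<times> words_of_length A m')"
proof (intro equalityI subsetI)
  fix w assume "w \<in> words_of_length A (m + m')"
  then have "take m w \<in> words_of_length A m" "drop m w \<in> words_of_length A m'"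
    by (auto simp: words_of_length_def dest: in_set_takeD in_set_dropD)
  then show "w \<in> (\<lambda>(u, v). u @ v) ` (words_of_length A m \<times> words_of_length A m')"
    by (intro image_eqI[of _ _ "(take m w, drop m w)"]) auto
qed (auto simp: words_of_length_def)

lemma profiles_add:
  assumes "states_below N n"
  shows "profiles N n (m + m') = (\<lambda>(a, b). a O b) ` (profiles N n m \<times> profiles N n m')"
  unfolding profiles_def words_of_length_add map_prod_surj_on[OF refl refl, symmetric] image_image
  by (rule image_cong) (auto simp: profile_append[OF assms])

text \<open>The powers of \<open>profiles N n 1\<close> are eventually periodic, with preperiod and period at most
  the number \<open>2 ^ 2 ^ (n * n)\<close> of sets of relations.\<close>

lemma profiles_fact:
  assumes "states_below N n"
  shows "profiles N n (fact (2 ^ 2 ^ (n * n))) = profiles N n (2 * fact (2 ^ 2 ^ (n * n)))"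
proof -
  define b :: nat where "b = 2 ^ 2 ^ (n * n)"
  let ?S = "profiles N n"
  have "profile N n w \<in> Pow ({..<n} \<times> {..<n})" for w
    by (auto simp: profile_def)
  then have sub: "?S ` {..b} \<subseteq> Pow (Pow ({..<n} \<times> {..<n}))"
    unfolding profiles_def by blast
  \<comment> \<open>There are \<open>b + 1\<close> lengths from 0 to \<open>b\<close> but at most
    \<open>b\<close> values, so two of them collide.\<close>
  have "card (?S ` {..b}) \<le> card (Pow (Pow ({..<n} \<times> {..<n})))"
    by (rule card_mono[OF _ sub]) simp
  also have "\<dots> = b" by (simp add: card_Pow b_def)
  finally have "\<not> inj_on ?S {..b}" by (auto dest: card_image)
  then obtain i j where ij: "i < j" "j \<le> b" "?S i = ?S j"
    unfolding inj_on_def by (metis atMost_iff linorder_neqE_nat)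
  define p where "p = j - i"
  have p: "0 < p" "p \<le> b" "?S i = ?S (i + p)" using ij by (auto simp: p_def)
  have period: "?S m = ?S (m + p * t)" if "i \<le> m" for m t
  proof (induction t)
    case (Suc t)
    define r where "r = m + p * t - i"
    have r: "m + p * t = i + r" "m + p * Suc t = (i + p) + r" using that by (auto simp: r_def)
    have "?S (i + r) = ?S ((i + p) + r)"
      by (simp only: profiles_add[OF assms, of i r] profiles_add[OF assms, of "i + p" r] p(3))
    with Suc.IH show ?case unfolding r by (simp only:)
  qed simp
  \<comment> \<open>\<open>fact b\<close> is a multiple of the period and lies beyond the preperiod,
    so doubling it changes nothing.\<close>
  have "p dvd fact b" using p by (intro dvd_fact) auto
  then obtain t where t: "fact b = p * t" by blast
  have "i \<le> fact b" using ij fact_ge_self[of b] by linarith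
  from period[OF this, of t] show ?thesis by (simp add: t mult_2 b_def[symmetric])
qed

text \<open>The inclusion from which the block map used for stretching is chosen.\<close>

definition stable_length :: "letter set \<Rightarrow> word set \<Rightarrow> nat \<Rightarrow> nat \<Rightarrow> bool" where
  "stable_length A L s d \<longleftrightarrow>
     (\<forall>u\<in>words_of_length A s. \<exists>v\<in>words_of_length A d. (u, v) \<in> syntactic_congruence A L)"

text \<open>Replacing the first block of length \<open>s\<close> by a congruent word of length
  \<open>2 * s\<close> lengthens a word by \<open>s\<close>.\<close>

lemma stable_length_mult:
  assumes "stable_length A L s (2 * s)" "0 < m"
  shows "stable_length A L s (m * s)"
  using assms(2)
proof (induction m)
  case (Suc m)
  show ?case
  proof (cases "m = 0")
    case True
    then show ?thesis by (auto simp: stable_length_def words_of_length_def syntactic_congruence_def)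
  next
    case False
    show ?thesis
      unfolding stable_length_def
    proof
      fix u assume "u \<in> words_of_length A s"
      then obtain v where v: "v \<in> words_of_length A (m * s)" "(u, v) \<in> syntactic_congruence A L"
        using Suc.IH False by (auto simp: stable_length_def)
      have "m * s = s + (m - 1) * s" using False by (cases m) auto
      then obtain v1 v2 where v12: "v = v1 @ v2" "v1 \<in> words_of_length A s"
          "v2 \<in> words_of_length A ((m - 1) * s)"
        using v(1) words_of_length_add[of A s "(m - 1) * s"] by auto
      obtain v1' where v1': "v1' \<in> words_of_length A (2 * s)" "(v1, v1') \<in> syntactic_congruence A L"
        using assms(1) v12(2) by (auto simp: stable_length_def)
      have "(v2, v2) \<in> syntactic_congruence A L"
        using v12(3) by (auto simp: syntactic_congruence_def words_of_length_def)
      then have "(v, v1' @ v2) \<in> syntactic_congruence A L"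
        using v1'(2) by (simp add: v12(1) syntactic_congruence_append)
      then have "(u, v1' @ v2) \<in> syntactic_congruence A L"
        using v(2) by (auto simp: syntactic_congruence_def)
      moreover have "v1' @ v2 \<in> words_of_length A (Suc m * s)"
        using v1'(1) v12(3) \<open>m * s = s + (m - 1) * s\<close> by (auto simp: words_of_length_def)
      ultimately show "\<exists>v\<in>words_of_length A (Suc m * s). (u, v) \<in> syntactic_congruence A L" by blast
    qed
  qed
qed simp

lemma stable_length_of_profiles:
  assumes "states_below N n" "profiles N n s \<subseteq> profiles N n d" "0 < s" "0 < d"
    and A: "A = set (alphabet N)"
  shows "stable_length A (nfa_language N - {[]}) s d"
  unfolding stable_length_def
proof
  fix u assume u: "u \<in> words_of_length A s"
  then obtain v where v: "v \<in> words_of_length A d" "profile N n u = profile N n v"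
    using assms(2) by (auto simp: profiles_def A)
  have "u \<in> lists A" "v \<in> lists A" "u \<noteq> []" "v \<noteq> []"
    using u v assms(3,4) by (auto simp: words_of_length_def)
  then show "\<exists>v\<in>words_of_length A d. (u, v) \<in> syntactic_congruence A (nfa_language N - {[]})"
    using syntactic_congruence_of_profile[OF assms(1) _ _ _ _ v(2) A] v(1) by blast
qed

text \<open>Codes of lists exceed their entries and codes of pairs are at least their components.
  The code of an automaton therefore bounds its states, which makes a stable length computable from
  the code.\<close>

lemma states_below_encode_nfa: "states_below N (encode_nfa N)"
proof (cases N)
  case (NFA as ts ss fs)
  let ?T = "map (\<lambda>(p, a, q). prod_encode (p, prod_encode (a, q))) ts"
  have below: "list_encode xs \<le> encode_nfa N" if "xs \<in> {?T, ss}" for xs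
    using that set_le_list_encode[of "list_encode xs"
        "[list_encode as, list_encode ?T, list_encode ss, list_encode fs]"]
    by (auto simp: NFA simp del: list_encode.simps)
  have "q < encode_nfa N" if "(p, a, q) \<in> set ts" for p a q
  proof -
    have "prod_encode (p, prod_encode (a, q)) \<in> set ?T" using that by force
    then have "prod_encode (p, prod_encode (a, q)) < encode_nfa N"
      using set_le_list_encode below[of ?T] by fastforce
    moreover have "q \<le> prod_encode (p, prod_encode (a, q))"
      using le_prod_encode_2[of q a] le_prod_encode_2[of "prod_encode (a, q)" p] by linarith
    ultimately show ?thesis by linarith
  qed
  moreover have "p < encode_nfa N" if "p \<in> set ss" for p
    using set_le_list_encode[OF that] below[of ss] by simp
  ultimately show ?thesis by (auto simp: states_below_def NFA simp del: encode_nfa.simps)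
qed

definition stable_bound :: "nat \<Rightarrow> nat" where
  "stable_bound n = fact (2 ^ 2 ^ (n * n))"

lemma stable_bound_pos: "0 < stable_bound n"
  by (simp add: stable_bound_def)

lemma stable_bound:
  assumes "A = set (alphabet N)"
  shows "stable_length A (nfa_language N - {[]}) (stable_bound (encode_nfa N)) (2 * stable_bound (encode_nfa N))"
    "stable_length A (nfa_language N - {[]}) (2 * stable_bound (encode_nfa N)) (stable_bound (encode_nfa N))"
  using profiles_fact[OF states_below_encode_nfa[of N]] assms
  by (auto simp: stable_bound_def simp del: encode_nfa.simps
      intro!: stable_length_of_profiles[OF states_below_encode_nfa])

lemma syntactic_morphism_eq_iff:
  assumes "u \<in> lists A" "v \<in> lists A"
  shows "syntactic_morphism A L u = syntactic_morphism A L v \<longleftrightarrow> (u, v) \<in> syntactic_congruence A L"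
proof
  have "v \<in> syntactic_morphism A L v"
    using assms by (simp add: syntactic_morphism_def syntactic_congruence_def)
  then show "(u, v) \<in> syntactic_congruence A L"
    if "syntactic_morphism A L u = syntactic_morphism A L v"
    using that by (metis Image_singleton_iff syntactic_morphism_def)
next
  assume "(u, v) \<in> syntactic_congruence A L"
  then show "syntactic_morphism A L u = syntactic_morphism A L v"
    unfolding syntactic_morphism_def syntactic_congruence_def by auto
qed

lemma stable_length_iff:
  "stable_length A L s d \<longleftrightarrow>
     syntactic_morphism A L ` words_of_length A s \<subseteq> syntactic_morphism A L ` words_of_length A d"
proof -
  have "(\<exists>v\<in>words_of_length A d. (u, v) \<in> syntactic_congruence A L) \<longleftrightarrow>
      syntactic_morphism A L u \<in> syntactic_morphism A L ` words_of_length A d"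
    if "u \<in> words_of_length A s" for u
    using that syntactic_morphism_eq_iff[of u A _ L] by (auto simp: words_of_length_def image_iff)
  then show ?thesis unfolding stable_length_def by blast
qed

text \<open>\<open>stable_bound\<close> supplies a stable length, so the minimum in the definition
  exists.\<close>

lemma stability_index:
  assumes "regular A L" "L \<subseteq> nonempty_words A"
  shows "0 < stability_index A L"
    "stable_length A L (stability_index A L) (2 * stability_index A L)"
proof -
  obtain N where N: "A = set (alphabet N)" "L = nfa_language N"
    using assms(1) by (auto simp: regular_def)
  have "L = nfa_language N - {[]}"
    using N(2) assms(2) by (auto simp: nonempty_words_def)
  then have "\<exists>s. 0 < s \<and> syntactic_morphism A L ` words_of_length A s =
      syntactic_morphism A L ` words_of_length A (2 * s)"
    using stable_bound[OF N(1)] stable_bound_pos[of "encode_nfa N"]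
    by (metis stable_length_iff subset_antisym)
  from LeastI_ex[OF this]
  show "0 < stability_index A L" "stable_length A L (stability_index A L) (2 * stability_index A L)"
    by (auto simp: stability_index_def stable_length_iff)
qed


section \<open>Automata for lifted languages\<close>

text \<open>The product of \<open>N\<close> with a counter modulo \<open>d\<close>, states being
  coded pairs. Only the sets are fixed, as the lists will come from a search.\<close>

definition is_lift_nfa :: "nat \<Rightarrow> nfa \<Rightarrow> nfa \<Rightarrow> bool" where
  "is_lift_nfa d N N' \<longleftrightarrow>
     set (alphabet N') = lifted_alphabet (set (alphabet N)) d \<and>
     set (transitions N') = {(prod_encode (p, i), prod_encode (a, i), prod_encode (q, Suc i mod d)) |
       p a q i. (p, a, q) \<in> set (transitions N) \<and> i < d} \<and>
     set (initial N') = {prod_encode (p, 0) | p. p \<in> set (initial N)} \<and>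
     set (final N') = {prod_encode (p, i) | p i. p \<in> set (final N) \<and> i < d}"

text \<open>The counter lets a letter pass only if its annotation equals the current value, which
  forces a correct annotation.\<close>

lemma accepts_from_lift_nfa:
  assumes N': "is_lift_nfa d N N'"
  shows "i < d \<Longrightarrow> accepts_from N' (prod_encode (p, i)) w \<longleftrightarrow>
    (\<exists>u. w = lift d i u \<and> accepts_from N p u)"
proof (induction w arbitrary: p i)
  case Nil
  have "[] = lift d i u \<longleftrightarrow> u = []" for u by (cases u) auto
  then show ?case using N' Nil by (auto simp: is_lift_nfa_def)
next
  case (Cons b w)
  have i: "Suc i mod d < d" using Cons.prems by simp
  have "accepts_from N' (prod_encode (p, i)) (b # w) \<longleftrightarrow>
      (\<exists>a q. b = prod_encode (a, i) \<and> (p, a, q) \<in> set (transitions N) \<and>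
        accepts_from N' (prod_encode (q, Suc i mod d)) w)"
    using N' Cons.prems by (auto simp: is_lift_nfa_def)
  also have "\<dots> \<longleftrightarrow> (\<exists>a q u. b = prod_encode (a, i) \<and> (p, a, q) \<in> set (transitions N) \<and>
        w = lift d (Suc i mod d) u \<and> accepts_from N q u)"
    by (simp add: Cons.IH[OF i])
  also have "\<dots> \<longleftrightarrow> (\<exists>a u. b # w = lift d i (a # u) \<and> accepts_from N p (a # u))"
    by auto
  also have "\<dots> \<longleftrightarrow> (\<exists>u. b # w = lift d i u \<and> accepts_from N p u)"
    by (metis lift.simps(1) list.distinct(1) list.exhaust)
  finally show ?case .
qed

lemma nfa_language_lift_nfa:
  assumes "is_lift_nfa d N N'" "0 < d"
  shows "nfa_language N' = lift d 0 ` nfa_language N"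
proof -
  let ?A = "set (alphabet N)"
  have A: "lift d 0 u \<in> lists (lifted_alphabet ?A d) \<longleftrightarrow> u \<in> lists ?A" for u
    using lift_in_lists[of u ?A 0 d] map_base_in_lists[of "lift d 0 u" ?A d] assms(2) by auto
  have "w \<in> nfa_language N' \<longleftrightarrow> w \<in> lists (lifted_alphabet ?A d) \<and>
      (\<exists>p\<in>set (initial N). accepts_from N' (prod_encode (p, 0)) w)" for w
    using assms(1) by (auto simp: nfa_language_def is_lift_nfa_def)
  also have "\<dots> w \<longleftrightarrow> (\<exists>u\<in>lists ?A. w = lift d 0 u \<and> (\<exists>p\<in>set (initial N). accepts_from N p u))" for w
    using A by (auto simp: accepts_from_lift_nfa[OF assms])
  finally show ?thesis by (auto simp: nfa_language_def)
qed

text \<open>Each of the four lists combines a list of \<open>N\<close> with an initial segment of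
  the numbers, the situation of \<open>computable_product\<close>.\<close>

lemma computable_lift_nfa:
  "\<exists>N'. computable 1 (\<lambda>xs. encode_nfa (N' (xs ! 0))) \<and>
    (\<forall>N. is_lift_nfa (stable_bound (encode_nfa N)) N (N' (encode_nfa N)))"
proof -
  define part where "part j x = code_hd (code_drop j x)" for j x
  have part: "computable 1 (\<lambda>xs. part j (xs ! 0))" for j
    unfolding part_def by (intro computable_intros) simp
  have bound: "computable 1 (\<lambda>xs. stable_bound (xs ! 0))"
    unfolding stable_bound_def by (intro computable_intros) simp_all
  have pair: "computable 3 (\<lambda>xs. prod_encode (xs ! 0, xs ! 1))"
    by (intro computable_intros) simp_all
  \<comment> \<open>This acts on the code of a transition and a counter value; the successor modulo
    \<open>d\<close> is a test for the last value, correct when \<open>i < d\<close>.\<close>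
  define trans where "trans e i d = (let p = fst (prod_decode e);
      a = fst (prod_decode (snd (prod_decode e))); q = snd (prod_decode (snd (prod_decode e))) in
      prod_encode (prod_encode (p, i), prod_encode (prod_encode (a, i),
        prod_encode (q, if d - Suc i = 0 then 0 else Suc i))))" for e i d
  have trans: "computable 3 (\<lambda>xs. trans (xs ! 0) (xs ! 1) (stable_bound (xs ! 2)))"
    unfolding trans_def Let_def stable_bound_def by (intro computable_intros) simp_all
  obtain as where as: "computable 1 (\<lambda>xs. list_encode (as (xs ! 0)))"
      "\<And>x es. part 0 x = list_encode es \<Longrightarrow>
        set (as x) = {prod_encode (e, i) | e i. e \<in> set es \<and> i < stable_bound x}"
    using computable_product[OF part bound pair] by blast
  obtain ts where ts: "computable 1 (\<lambda>xs. list_encode (ts (xs ! 0)))"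
      "\<And>x es. part 1 x = list_encode es \<Longrightarrow>
        set (ts x) = {trans e i (stable_bound x) | e i. e \<in> set es \<and> i < stable_bound x}"
    using computable_product[OF part bound trans] by blast
  \<comment> \<open>The bound 1 makes 0 the only counter value in initial states.\<close>
  obtain "is" where "is": "computable 1 (\<lambda>xs. list_encode (is (xs ! 0)))"
      "\<And>x es. part 2 x = list_encode es \<Longrightarrow>
        set (is x) = {prod_encode (e, i) | e i. e \<in> set es \<and> i < 1}"
    using computable_product[OF part computable_const pair] by blast
  obtain fs where fs: "computable 1 (\<lambda>xs. list_encode (fs (xs ! 0)))"
      "\<And>x es. part 3 x = list_encode es \<Longrightarrow>
        set (fs x) = {prod_encode (e, i) | e i. e \<in> set es \<and> i < stable_bound x}"
    using computable_product[OF part bound pair] by blast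
  \<comment> \<open>Every number codes a triple, so the computed list of codes can be read as the
    transitions of an automaton whose code contains that very list.\<close>
  define decode where "decode e = (fst (prod_decode e), fst (prod_decode (snd (prod_decode e))),
    snd (prod_decode (snd (prod_decode e))))" for e
  have decode: "map (\<lambda>(p, a, q). prod_encode (p, prod_encode (a, q))) (map decode es) = es" for es
    by (simp add: decode_def map_idI)
  define N' where "N' x = NFA (as x) (map decode (ts x)) (is x) (fs x)" for x
  have "computable 1 (\<lambda>xs. encode_nfa (N' (xs ! 0)))"
    unfolding N'_def encode_nfa.simps decode list_encode.simps
    by (intro computable_intros as(1) ts(1) "is"(1) fs(1))
  moreover have "is_lift_nfa (stable_bound (encode_nfa N)) N (N' (encode_nfa N))" for N
  proof -
    obtain as0 ts0 is0 fs0 where N: "N = NFA as0 ts0 is0 fs0" by (cases N)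
    define x where "x = encode_nfa N"
    let ?d = "stable_bound x"
    have parts: "part 0 x = list_encode as0"
      "part 1 x = list_encode (map (\<lambda>(p, a, q). prod_encode (p, prod_encode (a, q))) ts0)"
      "part 2 x = list_encode is0" "part 3 x = list_encode fs0"
      by (simp_all add: part_def x_def N numeral_2_eq_2 numeral_3_eq_3 del: list_encode.simps)
    have d: "Suc i mod ?d = (if ?d - Suc i = 0 then 0 else Suc i)" if "i < ?d" for i
      using that by (cases "Suc i = ?d") auto
    have tr: "decode (trans (prod_encode (p, prod_encode (a, q))) i ?d) =
        (prod_encode (p, i), prod_encode (a, i), prod_encode (q, Suc i mod ?d))" if "i < ?d" for p a q i
      using d[OF that] by (simp add: decode_def trans_def)
    have "decode ` set (ts x) = {(prod_encode (p, i), prod_encode (a, i), prod_encode (q, Suc i mod ?d)) |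
       p a q i. (p, a, q) \<in> set ts0 \<and> i < ?d}"
      unfolding ts(2)[OF parts(2)]
    proof (intro equalityI subsetI)
      fix z assume "z \<in> decode ` {trans e i ?d | e i.
        e \<in> set (map (\<lambda>(p, a, q). prod_encode (p, prod_encode (a, q))) ts0) \<and> i < ?d}"
      then obtain p a q i where "(p, a, q) \<in> set ts0" "i < ?d"
          "z = decode (trans (prod_encode (p, prod_encode (a, q))) i ?d)" by auto
      then show "z \<in> {(prod_encode (p, i), prod_encode (a, i), prod_encode (q, Suc i mod ?d)) |
          p a q i. (p, a, q) \<in> set ts0 \<and> i < ?d}"
        using tr by blast
    next
      fix z assume "z \<in> {(prod_encode (p, i), prod_encode (a, i), prod_encode (q, Suc i mod ?d)) |
          p a q i. (p, a, q) \<in> set ts0 \<and> i < ?d}"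
      then obtain p a q i where z: "(p, a, q) \<in> set ts0" "i < ?d"
          "z = (prod_encode (p, i), prod_encode (a, i), prod_encode (q, Suc i mod ?d))" by blast
      have "z = decode (trans (prod_encode (p, prod_encode (a, q))) i ?d)"
        using z(3) tr[OF z(2)] by simp
      moreover have "prod_encode (p, prod_encode (a, q)) \<in>
          set (map (\<lambda>(p, a, q). prod_encode (p, prod_encode (a, q))) ts0)"
        using z(1) by force
      ultimately show "z \<in> decode ` {trans e i ?d | e i.
          e \<in> set (map (\<lambda>(p, a, q). prod_encode (p, prod_encode (a, q))) ts0) \<and> i < ?d}"
        using z(2) by blast
    qed
    moreover have "set (as x) = lifted_alphabet (set as0) ?d"
      unfolding as(2)[OF parts(1)] lifted_alphabet_def by auto
    ultimately show ?thesis
      using "is"(2)[OF parts(3)] fs(2)[OF parts(4)]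
      unfolding x_def[symmetric] by (auto simp: is_lift_nfa_def N'_def N)
  qed
  ultimately show ?thesis by blast
qed


section \<open>The transfer theorem\<close>

lemma definable_plus_mono: "F \<subseteq> G \<Longrightarrow> definable_plus F A L \<Longrightarrow> definable_plus G A L"
  by (auto simp: definable_plus_def)

lemma modulus_preds_subset: "modulus_preds d \<subseteq> MOD_of d"
  by (auto simp: modulus_preds_def)

lemma MOD_of_subset: "0 < d \<Longrightarrow> MOD_of d \<subseteq> MOD_all"
  by (auto simp: MOD_all_def Suc_le_eq)

context logic_variety
begin

abbreviation enriched :: "pred set \<Rightarrow> mso set" where
  "enriched X \<equiv> enrichment \<sigma> F (plus_one \<union> X)"

lemma enriched_mono: "X \<subseteq> Y \<Longrightarrow> definable_plus (enriched X) A L \<Longrightarrow> definable_plus (enriched Y) A L"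
  using definable_plus_mono[OF enrichment_mono] Un_mono[OF subset_refl] by metis

text \<open>The formula provides some modulus \<open>d\<close>. It is enlarged to
  \<open>d * s\<close>, a multiple of \<open>s\<close> to which blocks of length \<open>s\<close>
  can be stretched, and then reduced to \<open>s\<close>.\<close>

lemma window_definable_stable:
  assumes "finite A" "0 < s" "stable_length A L s (2 * s)"
    and "definable_plus (enriched MOD_all) A L"
  shows "\<exists>k. window_definable F k s A L"
proof -
  have "\<exists>e\<in>{1..}. d dvd e \<and> d' dvd e" if "d \<in> {1..}" "d' \<in> {1..}" for d d' :: nat
    using that by (intro bexI[of _ "d * d'"]) auto
  then obtain k d where kd: "d \<in> {1..}" "window_definable F k d A L"
    using window_definable_of_definable_plus[of A "{1..}" L] assms(1,4)
    unfolding MOD_all_def by auto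
  then have d: "0 < d" by auto
  have "window_definable F k (d * s) A L"
    using window_definable_dvd[OF kd(2) assms(1) d, of "d * s"] assms(2) d by simp
  moreover have "stable_length A L s (d * s)"
    using stable_length_mult[OF assms(3) d] .
  moreover have "s \<le> d * s" using d by simp
  ultimately show ?thesis
    using window_definable_unstretch[OF _ assms(1,2)] unfolding stable_length_def by blast
qed

lemma definable_plus_MOD_stable:
  assumes "finite A" "L \<subseteq> nonempty_words A" "0 < s" "stable_length A L s (2 * s)"
    and "definable_plus (enriched MOD_all) A L"
  shows "definable_plus (enriched (MOD_of s)) A L"
proof -
  obtain k where "window_definable F k s A L"
    using window_definable_stable assms by blast
  from definable_plus_of_window_definable[OF assms(1,3,2) this]
  show ?thesis using enriched_mono[OF modulus_preds_subset] by blast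
qed

text \<open>Windows modulo \<open>s\<close> link the two sides: the annotations of the lifted word
  carry the residues, so its own windows only need modulus 1.\<close>

lemma definable_plus_MOD_iff_lift:
  assumes A: "finite A" and L: "L \<subseteq> nonempty_words A" and s: "0 < s" "stable_length A L s (2 * s)"
  shows "definable_plus (enriched MOD_all) A L \<longleftrightarrow>
    definable_plus (enrichment \<sigma> F plus_one) (lifted_alphabet A s) (lift s 0 ` L)"
proof
  assume "definable_plus (enriched MOD_all) A L"
  then obtain k where "window_definable F k s A L"
    using window_definable_stable assms by blast
  then have windows: "window_definable F (k + 2) 1 (lifted_alphabet A s) (lift s 0 ` L)"
    using window_definable_lift A s(1) L by blast
  have "lift s 0 ` L \<subseteq> nonempty_words (lifted_alphabet A s)"
  proof
    fix v assume "v \<in> lift s 0 ` L"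
    then obtain u where u: "u \<in> L" "v = lift s 0 u" by blast
    then have "u \<in> lists A" "u \<noteq> []" "length v = length u" using L by (auto simp: nonempty_words_def)
    moreover from this have "v \<noteq> []" by auto
    ultimately show "v \<in> nonempty_words (lifted_alphabet A s)"
      using lift_in_lists[of u A 0 s] s(1) u(2) by (auto simp: nonempty_words_def)
  qed
  from definable_plus_of_window_definable[OF finite_lifted_alphabet[OF A] zero_less_one this windows]
  show "definable_plus (enrichment \<sigma> F plus_one) (lifted_alphabet A s) (lift s 0 ` L)"
    by (simp add: modulus_preds_def)
next
  assume "definable_plus (enrichment \<sigma> F plus_one) (lifted_alphabet A s) (lift s 0 ` L)"
  then have "definable_plus (enriched {}) (lifted_alphabet A s) (lift s 0 ` L)" by simp
  \<comment> \<open>Predicates of modulus 1 are added so that the passage from formulas to windows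
    applies with 1 as the only modulus.\<close>
  then have "definable_plus (enriched (\<Union>d\<in>{1}. MOD_of d)) (lifted_alphabet A s) (lift s 0 ` L)"
    by (rule enriched_mono[rotated]) simp
  then obtain k where "window_definable F k 1 (lifted_alphabet A s) (lift s 0 ` L)"
    using window_definable_of_definable_plus[of "lifted_alphabet A s" "{1}" "lift s 0 ` L"]
      finite_lifted_alphabet[OF A] by auto
  then have "window_definable F k s A L"
    using window_definable_of_lift A s(1) by blast
  from definable_plus_of_window_definable[OF A s(1) L this]
  show "definable_plus (enriched MOD_all) A L"
    using enriched_mono[OF order_trans[OF modulus_preds_subset MOD_of_subset]] s(1) by blast
qed

lemma decidable_plus_MOD:
  assumes "decidable_plus (enrichment \<sigma> F plus_one)"
  shows "decidable_plus (enriched MOD_all)"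
proof -
  obtain f where f: "recursive 1 f" "\<And>N. f [encode_nfa N] =
      (if definable_plus (enrichment \<sigma> F plus_one) (set (alphabet N)) (nfa_language N - {[]}) then 1 else 0)"
    using assms unfolding decidable_plus_def by blast
  obtain N' where N': "computable 1 (\<lambda>xs. encode_nfa (N' (xs ! 0)))"
      "\<And>N. is_lift_nfa (stable_bound (encode_nfa N)) N (N' (encode_nfa N))"
    using computable_lift_nfa by blast
  have "computable 1 f" using f(1) unfolding computable_def by blast
  then have "computable 1 (\<lambda>xs. f [xs ! 0])"
    by (rule computable_cong) (auto simp: length_Suc_conv)
  from computable_comp1[OF this N'(1)]
  obtain g where g: "recursive 1 g" "\<And>xs. length xs = 1 \<Longrightarrow> g xs = f [encode_nfa (N' (xs ! 0))]"
    unfolding computable_def by blast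
  have "g [encode_nfa N] =
      (if definable_plus (enriched MOD_all) (set (alphabet N)) (nfa_language N - {[]}) then 1 else 0)" for N
  proof -
    let ?s = "stable_bound (encode_nfa N)" and ?A = "set (alphabet N)" and ?M = "N' (encode_nfa N)"
    have "nfa_language N - {[]} \<subseteq> nonempty_words ?A"
      by (auto simp: nfa_language_def nonempty_words_def)
    then have "definable_plus (enriched MOD_all) ?A (nfa_language N - {[]}) \<longleftrightarrow>
        definable_plus (enrichment \<sigma> F plus_one) (lifted_alphabet ?A ?s) (lift ?s 0 ` (nfa_language N - {[]}))"
      by (intro definable_plus_MOD_iff_lift stable_bound_pos stable_bound) auto
    also have "lifted_alphabet ?A ?s = set (alphabet ?M)"
      using N'(2)[of N] by (simp add: is_lift_nfa_def)
    \<comment> \<open>The empty word is its own annotation and \<open>lift\<close> is injective, so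
      removing the empty word commutes with lifting.\<close>
    also have "lift ?s 0 ` (nfa_language N - {[]}) = nfa_language ?M - {[]}"
      using nfa_language_lift_nfa[OF N'(2) stable_bound_pos, of N]
      by (simp add: image_set_diff[OF inj_lift])
    finally show ?thesis using f(2)[of ?M] g(2)[of "[encode_nfa N]"] by simp
  qed
  then show ?thesis unfolding decidable_plus_def using g(1) by blast
qed

end

theorem theorem9:
  fixes \<sigma> :: "numpred set" and F :: "mso set" and V :: "nat monoid set"
  assumes "fragment \<sigma> F"
    and "monoid_variety V"
    and "equivalent_to_variety F V"
    and "\<not> variety_of_groups V"
  shows "(\<forall>A L. finite A \<and> L \<subseteq> nonempty_words A \<and> regular A L \<longrightarrow>
            definable_plus (enrichment \<sigma> F (plus_one \<union> MOD_all)) A L \<longleftrightarrow>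
            definable_plus (enrichment \<sigma> F (plus_one \<union> MOD_of (stability_index A L))) A L)
       \<and> (decidable_plus (enrichment \<sigma> F plus_one) \<longrightarrow>
            decidable_plus (enrichment \<sigma> F (plus_one \<union> MOD_all)))"
proof -
  interpret logic_variety \<sigma> F V
    using assms by unfold_locales
  \<comment> \<open>The stability index is a stable length, which gives one direction; it is also
    positive, so the converse is monotonicity in the signature.\<close>
  have "definable_plus (enriched MOD_all) A L \<longleftrightarrow>
      definable_plus (enriched (MOD_of (stability_index A L))) A L"
    if "finite A" "L \<subseteq> nonempty_words A" "regular A L" for A L
    using definable_plus_MOD_stable[OF that(1,2) stability_index[OF that(3,2)]]
      enriched_mono[OF MOD_of_subset[OF stability_index(1)[OF that(3,2)]]] by blast
  then show ?thesis using decidable_plus_MOD by blast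
qed

end
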